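(* Let $\alpha>0$, $1\le p,q\le\infty$, let $\omega:[a,b]\to\mathbb{R}^d$ be a path, and let $r>1$. Suppose that the occupation measure $\mu$ of $\omega$ satisfies $\mu_{a,\cdot}\in V^r(a,b;\mathrm{SBE}^{\alpha,p}_q)$. Let $\varphi:[a',b']\to[a,b]$ be a bi-Lipschitz map with $\varphi'\in V^{r'-\epsilon}(a',b';\mathbb{R})$ for some $\epsilon>0$, where $r'$ is the Hölder conjugate of $r$. Then the occupation measure $\mu^\varphi$ of $\omega\circ\varphi:[a',b']\to\mathbb{R}^d$ satisfies $\mu^\varphi_{a',\cdot}\in V^r(a',b';\mathrm{SBE}^{\alpha,p}_q)$ as well.
   Context: The occupation measure of a path $\omega:[a,b]\to\mathbb{R}^d$ is $\mu_{s,t}=\int_s^t\delta_{\omega_\tau}\,d\tau$, i.e. $\mu_{s,t}(A)=\mathrm{Leb}\{\tau\in[s,t]:\omega_\tau\in A\}$, and $\mu_{a,\cdot}$ denotes $t\mapsto\mu_{a,t}$. For a normed space $E$, $V^p(a,b;E)$ is the set of $f:[a,b]\to E$ with $\sup\sum_{h=1}^n\|f(t_h)-f(t_{h-1})\|_E^p<\infty$, the supremum being over all finite partitions $a=t_0<t_1<\dots<t_n=b$. $\mathbb{R}^+=(0,\infty)$. For a finite measure $\mu$ on $\mathbb{R}^d$ set $F_\mu(r,y)=\mu(\{x\in\mathbb{R}^d:|x-y|\le r\})$. For a function $F$ of $r$ define recursively $\Delta_0F(r)=F(r)-F(r/2)$, $\Delta_{k+1}F(r)=\Delta_kF(r)-2^{k+1}\Delta_kF(r/2)$.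 For $\alpha>0$, $1\le p,q\le\infty$ and $k=\lceil\alpha+d-1\rceil$, set $$\|\mu\|_{\mathrm{SBE}^{\alpha,p}_q}=\big\|r^{-\alpha-d}(\Delta_k)_rF_\mu(r,y)\big\|_{L^q_yL^p_r(\mathbb{R}^d\times\mathbb{R}^+,\,dy\otimes\frac{dr}{r})},$$ where $(\Delta_k)_r$ acts in $r$, the $L^p$ norm in $r$ (w.r.t. $dr/r$) is taken first and then the $L^q$ norm in $y$. A compactly supported finite measure is in $\mathrm{SBE}^{\alpha,p}_q$ if this quantity is finite. *)

theory Defs
  imports "HOL-Analysis.Analysis" "HOL-Probability.Essential_Supremum"
begin

section \<open>Functions of finite \<open>p\<close>-variation\<close>

definition interval_partition :: "real \<Rightarrow> real \<Rightarrow> nat \<Rightarrow> (nat \<Rightarrow> real) \<Rightarrow> bool" where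
  "interval_partition a b n t \<longleftrightarrow> t 0 = a \<and> t n = b \<and> (\<forall>h<n. t h < t (Suc h))"

definition epowr :: "ennreal \<Rightarrow> real \<Rightarrow> ennreal" where
  "epowr x p = (if x = \<infinity> then \<infinity> else ennreal (enn2real x powr p))"

text \<open>
  The normed space is given by its carrier \<open>E\<close> and its norm \<open>N\<close>. The latter is allowed to be
  an extended norm on a larger type, finite on \<open>E\<close>, so that function spaces can be used directly.
\<close>

definition finite_variation_space ::
  "real \<Rightarrow> real \<Rightarrow> real \<Rightarrow> 'e set \<Rightarrow> ('e \<Rightarrow> ennreal) \<Rightarrow> (real \<Rightarrow> 'e::minus) set" where
  "finite_variation_space p a b E N =
     {f. (\<forall>t\<in>{a..b}. f t \<in> E) \<and>
         (SUP (n, t) \<in> {(n, t). interval_partition a b n t}.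
            \<Sum>h=1..n. epowr (N (f (t h) - f (t (h - 1)))) p) < \<infinity>}"


section \<open>Spherical Besov spaces of finite signed measures\<close>

text \<open>
  \<open>Lnorm p M f\<close> is the \<open>L\<^sup>p(M)\<close> norm of a function \<open>f \<ge> 0\<close>, for \<open>1 \<le> p \<le> \<infinity>\<close>.
\<close>

definition Lnorm :: "ennreal \<Rightarrow> 'a measure \<Rightarrow> ('a \<Rightarrow> ennreal) \<Rightarrow> ennreal" where
  "Lnorm p M f =
     (if p = \<infinity> then esssup M f
      else epowr (\<integral>\<^sup>+x. epowr (f x) (enn2real p) \<partial>M) (1 / enn2real p))"

text \<open>The measure \<open>dr/r\<close> on \<open>(0,\<infinity>)\<close>, extended by zero to the real line.\<close>

definition dr_over_r :: "real measure" where
  "dr_over_r = density lborel (\<lambda>r. ennreal (indicator {0<..} r / r))"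

text \<open>
  Differences of measures are needed, so finite measures are signed here. They are represented as
  real-valued set functions, of which only the values on Borel sets are relevant; the values on
  other sets are unconstrained. Countable additivity applied to the constant family of empty sets
  yields \<open>\<nu> {} = 0\<close>.
\<close>

definition finite_signed_measure :: "('a::topological_space set \<Rightarrow> real) \<Rightarrow> bool" where
  "finite_signed_measure \<nu> \<longleftrightarrow>
     (\<forall>A :: nat \<Rightarrow> 'a set. range A \<subseteq> sets borel \<longrightarrow> disjoint_family A \<longrightarrow>
        (\<lambda>i. \<nu> (A i)) sums \<nu> (\<Union>i. A i))"

definition compactly_supported :: "('a::topological_space set \<Rightarrow> real) \<Rightarrow> bool" where
  "compactly_supported \<nu> \<longleftrightarrow>
     (\<exists>K. compact K \<and> (\<forall>A\<in>sets borel. A \<inter> K = {} \<longrightarrow> \<nu> A = 0))"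

definition ball_mass :: "('a::metric_space set \<Rightarrow> real) \<Rightarrow> real \<Rightarrow> 'a \<Rightarrow> real" where
  "ball_mass \<nu> r y = \<nu> {x. dist x y \<le> r}"

primrec Delta :: "nat \<Rightarrow> (real \<Rightarrow> real) \<Rightarrow> real \<Rightarrow> real" where
  "Delta 0 F r = F r - F (r / 2)"
| "Delta (Suc k) F r = Delta k F r - 2 ^ (k + 1) * Delta k F (r / 2)"

definition SBE_norm ::
  "real \<Rightarrow> ennreal \<Rightarrow> ennreal \<Rightarrow> ('a::euclidean_space set \<Rightarrow> real) \<Rightarrow> ennreal" where
  "SBE_norm \<alpha> p q \<nu> =
     (let d = real DIM('a); k = nat \<lceil>\<alpha> + d - 1\<rceil> in
      Lnorm q lborel (\<lambda>y. Lnorm p dr_over_r (\<lambda>r.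
        ennreal \<bar>r powr (- \<alpha> - d) * Delta k (\<lambda>s. ball_mass \<nu> s y) r\<bar>)))"

definition SBE :: "real \<Rightarrow> ennreal \<Rightarrow> ennreal \<Rightarrow> ('a::euclidean_space set \<Rightarrow> real) set" where
  "SBE \<alpha> p q =
     {\<nu>. finite_signed_measure \<nu> \<and> compactly_supported \<nu> \<and> SBE_norm \<alpha> p q \<nu> < \<infinity>}"


section \<open>Occupation measures and bi-Lipschitz maps\<close>

definition occupation_measure :: "(real \<Rightarrow> 'a) \<Rightarrow> real \<Rightarrow> real \<Rightarrow> 'a set \<Rightarrow> real" where
  "occupation_measure \<omega> s t A = measure lebesgue {\<tau> \<in> {s..t}. \<omega> \<tau> \<in> A}"

definition bilipschitz_on :: "'a::metric_space set \<Rightarrow> ('a \<Rightarrow> 'b::metric_space) \<Rightarrow> bool" where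
  "bilipschitz_on S f \<longleftrightarrow>
     (\<exists>c>0. \<exists>C>0. \<forall>x\<in>S. \<forall>y\<in>S.
        c * dist x y \<le> dist (f x) (f y) \<and> dist (f x) (f y) \<le> C * dist x y)"

end

theory Submission
  imports Defs
begin

text \<open>
  By the substitution \<open>u = \<phi> \<tau>\<close>, an increment of the occupation measure of \<open>\<omega> \<circ> \<phi>\<close> is the integral
  of \<open>1 / \<bar>\<phi>'\<bar>\<close> against the occupation measure of \<open>\<omega>\<close>, taken along \<open>\<phi>\<close>. The integrator has
  finite \<open>r\<close>-variation in the Besov norm, and the integrand has finite \<open>(r' - \<epsilon>)\<close>-variation because
  \<open>\<bar>\<phi>'\<bar>\<close> is bounded below by the lower Lipschitz constant of \<open>\<phi>\<close>. As \<open>1/r + 1/(r' - \<epsilon>) > 1\<close>,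
  Young's inequality bounds the norm of the integral over an interval by a multiple of the
  \<open>r\<close>-variation of the integrator over that interval, and the \<open>r\<close>-th powers of these bounds add up.

  All measures are written in the time of the new path, as
  \<open>A \<mapsto> \<integral> h(\<tau>) 1\<^sub>A(\<omega>(\<phi> \<tau>)) d\<tau>\<close> for scalar weights \<open>h\<close> on \<open>[a', b']\<close> (\<open>weighted_image\<close>).
  With \<open>m = \<bar>\<phi>'\<bar>\<close>, the weight \<open>m 1\<^sub>(\<^sub>s\<^sub>,\<^sub>t\<^sub>]\<close> gives, up to sign, the increment of the old occupation
  measure from \<open>\<phi> s\<close> to \<open>\<phi> t\<close> (\<open>measure_segment_eq_weighted\<close>), and the weight \<open>1\<^sub>(\<^sub>s\<^sub>,\<^sub>t\<^sub>]\<close> gives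
  the increment of the new one. Hence \<open>1 / m\<close> is integrated against the interval function
  \<open>m 1\<^sub>(\<^sub>s\<^sub>,\<^sub>t\<^sub>]\<close>.

  Both variation hypotheses enter through a control: a nondecreasing function \<open>W\<close> such that increments
  over \<open>[s, t]\<close> are bounded by a power of \<open>W t - W s\<close> (\<open>finite_variation_space_control\<close>). The sum
  of two controls controls both functions, so that one additive quantity drives Young's argument
  (\<open>young_riemann_sum_bound\<close>). Moreover \<open>W\<close> has only countably many discontinuities, and away from
  them the integrand is continuous; this makes it measurable and makes the weights of the Riemann
  sums converge almost everywhere.

  Young's bound passes from the Riemann sums to the integral: it is uniform, the measures defined by
  the sums converge on every Borel set, and the norm is lower semicontinuous for this convergence
  (\<open>SBE_norm_le_limit\<close>), by Fatou's lemma applied to the inner and to the outer norm.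
\<close>

section \<open>Lebesgue norms of extended nonnegative functions\<close>

lemma epowr_ennreal: "0 \<le> x \<Longrightarrow> epowr (ennreal x) p = ennreal (x powr p)"
  by (simp add: epowr_def)

lemma epowr_mono: "x \<le> y \<Longrightarrow> 0 \<le> p \<Longrightarrow> epowr x p \<le> epowr y p"
  by (auto simp: epowr_def top_unique less_top intro!: ennreal_leI powr_mono2 enn2real_mono)

lemma epowr_inverse: "0 < p \<Longrightarrow> epowr (epowr x p) (1 / p) = x"
  by (cases x) (auto simp: epowr_def powr_powr)

lemma epowr_inverse': "0 < p \<Longrightarrow> epowr (epowr x (1 / p)) p = x"
  using epowr_inverse[of "1 / p" x] by simp

lemma epowr_le_iff: "0 < p \<Longrightarrow> 0 \<le> c \<Longrightarrow> epowr x (1 / p) \<le> ennreal c \<longleftrightarrow> x \<le> ennreal (c powr p)"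
  by (metis epowr_ennreal epowr_inverse epowr_inverse' epowr_mono less_eq_real_def zero_less_divide_1_iff)

lemma epowr_le_iff': "0 < p \<Longrightarrow> 0 \<le> c \<Longrightarrow> epowr x p \<le> ennreal c \<longleftrightarrow> x \<le> ennreal (c powr (1 / p))"
  using epowr_le_iff[of "1 / p" c x] by simp

lemma epowr_measurable [measurable]:
  "f \<in> borel_measurable M \<Longrightarrow> (\<lambda>x. epowr (f x) p) \<in> borel_measurable M"
  unfolding epowr_def
  using measurable_sets[of f M borel "{\<infinity>}"]
  by (intro measurable_If) (auto simp: vimage_def Int_def conj_commute)

lemma epowr_cmult:
  assumes "0 < c" "0 < p"
  shows "epowr (ennreal c * x) p = ennreal (c powr p) * epowr x p"
  using assms
  by (cases x) (auto simp: epowr_def ennreal_mult[symmetric] powr_mult ennreal_mult_top ennreal_mult_eq_top_iff)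

text \<open>
  This is convexity of \<open>t \<mapsto> t\<^sup>p\<close>: the quotient \<open>(x + y) / (a + b)\<close> is the average of \<open>x / a\<close> and
  \<open>y / b\<close> with weights \<open>a / (a + b)\<close> and \<open>b / (a + b)\<close>. Integrated with \<open>a\<close> and \<open>b\<close> the norms of two
  functions, it becomes Minkowski's inequality.
\<close>

lemma epowr_add_le:
  assumes "1 \<le> p" "0 < a" "0 < b"
  shows "epowr (x + y) p \<le> ennreal ((a + b) powr (p - 1) * a powr (1 - p)) * epowr x p
           + ennreal ((a + b) powr (p - 1) * b powr (1 - p)) * epowr y p"
proof (cases "x = \<infinity> \<or> y = \<infinity>")
  case True
  then show ?thesis
    using assms by (auto simp: epowr_def ennreal_mult_top)
next
  case False
  then obtain u v where uv: "x = ennreal u" "y = ennreal v" "0 \<le> u" "0 \<le> v"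
    by (cases x; cases y) auto
  have jensen: "((a / (a + b)) *\<^sub>R (u / a) + (b / (a + b)) *\<^sub>R (v / b)) powr p
      \<le> a / (a + b) * (u / a) powr p + b / (a + b) * (v / b) powr p" if "0 < u" "0 < v"
    using convex_onD[OF powr_convex[OF assms(1)], of "b / (a + b)" "u / a" "v / b"] assms that
    by (simp add: field_simps)
  have average: "(a / (a + b)) *\<^sub>R (u / a) + (b / (a + b)) *\<^sub>R (v / b) = (u + v) / (a + b)"
    using assms by (simp add: add_divide_distrib)
  have shrink: "(t * x) powr p \<le> t * x powr p" if "0 < t" "t < 1" "0 \<le> x" for x t :: real
    using powr_mono'[of 1 p t] that assms by (simp add: powr_mult mult_right_mono)
  have "(u + v) powr p / (a + b) powr p
      \<le> a / (a + b) * (u powr p / a powr p) + b / (a + b) * (v powr p / b powr p)"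
  proof (cases "u = 0 \<or> v = 0")
    case False
    then show ?thesis using jensen[unfolded average] assms uv by (simp add: powr_divide)
  next
    case True
    have "(b / (a + b) * (v / b)) powr p \<le> b / (a + b) * (v / b) powr p"
         "(a / (a + b) * (u / a)) powr p \<le> a / (a + b) * (u / a) powr p"
      using assms uv by (intro shrink; simp)+
    then show ?thesis using assms uv True by (auto simp: powr_divide)
  qed
  then have "(u + v) powr p
      \<le> (a + b) powr p * (a / (a + b) * (u powr p / a powr p) + b / (a + b) * (v powr p / b powr p))"
    using assms by (simp add: divide_le_eq mult.commute)
  also have "\<dots> = (a + b) powr (p - 1) * a powr (1 - p) * u powr p
      + (a + b) powr (p - 1) * b powr (1 - p) * v powr p"
    using assms by (simp add: powr_diff field_simps)
  finally show ?thesis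
    using uv by (simp add: epowr_def ennreal_mult[symmetric] flip: ennreal_plus)
qed

lemma one_le_enn2real: "1 \<le> p \<Longrightarrow> p \<noteq> \<infinity> \<Longrightarrow> 1 \<le> enn2real p"
  by (cases p) auto

lemma Lnorm_le_iff:
  assumes "1 \<le> p" "p \<noteq> \<infinity>" "0 \<le> c"
  shows "Lnorm p M f \<le> ennreal c \<longleftrightarrow> (\<integral>\<^sup>+x. epowr (f x) (enn2real p) \<partial>M) \<le> ennreal (c powr enn2real p)"
  using one_le_enn2real[OF assms(1,2)] assms by (simp add: Lnorm_def epowr_le_iff)

lemma Lnorm_mono:
  assumes "1 \<le> p" and [measurable]: "f \<in> borel_measurable M"
    and le: "\<And>x. f x \<le> g x"
  shows "Lnorm p M f \<le> Lnorm p M g"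
proof (cases "p = \<infinity>")
  case True
  then show ?thesis by (simp add: Lnorm_def esssup_mono le)
next
  case False
  then show ?thesis
    using one_le_enn2real[OF assms(1) False]
    by (auto simp: Lnorm_def intro!: epowr_mono nn_integral_mono le)
qed

text \<open>
  Minkowski's inequality. The averaging argument needs positive bounds for the two norms, so it is
  carried out with bounds enlarged by \<open>e / 2\<close>, and \<open>e\<close> tends to zero.
\<close>

lemma Lnorm_add_le:
  assumes p: "1 \<le> p" and [measurable]: "f \<in> borel_measurable M" "g \<in> borel_measurable M"
  shows "Lnorm p M (\<lambda>x. f x + g x) \<le> Lnorm p M f + Lnorm p M g"
proof (cases "p = \<infinity>")
  case True
  have "AE x in M. f x + g x \<le> esssup M f + esssup M g"
    using esssup_AE[where M = M and f = f] esssup_AE[where M = M and f = g] by eventually_elim (rule add_mono)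
  then show ?thesis
    using True by (auto simp: Lnorm_def)
next
  case False
  define P where "P = enn2real p"
  have P: "1 \<le> P" using one_le_enn2real[OF p False] by (simp add: P_def)
  have pos: "Lnorm p M (\<lambda>x. f x + g x) \<le> ennreal (a + b)"
    if ab: "0 < a" "0 < b" "Lnorm p M f \<le> ennreal a" "Lnorm p M g \<le> ennreal b" for a b
  proof -
    let ?A = "(a + b) powr (P - 1) * a powr (1 - P)"
    let ?B = "(a + b) powr (P - 1) * b powr (1 - P)"
    have "(\<integral>\<^sup>+x. epowr (f x + g x) P \<partial>M)
        \<le> (\<integral>\<^sup>+x. ennreal ?A * epowr (f x) P + ennreal ?B * epowr (g x) P \<partial>M)"
      using P ab by (intro nn_integral_mono epowr_add_le) auto
    also have "\<dots> = ennreal ?A * (\<integral>\<^sup>+x. epowr (f x) P \<partial>M) + ennreal ?B * (\<integral>\<^sup>+x. epowr (g x) P \<partial>M)"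
      by (subst nn_integral_add) (auto simp: nn_integral_cmult)
    also have "\<dots> \<le> ennreal ?A * ennreal (a powr P) + ennreal ?B * ennreal (b powr P)"
      using ab p False by (intro add_mono mult_left_mono) (auto simp: Lnorm_le_iff P_def)
    also have "\<dots> = ennreal (?A * a powr P + ?B * b powr P)"
      by (simp add: ennreal_mult[symmetric] flip: ennreal_plus)
    also have "?A * a powr P + ?B * b powr P = (a + b) powr (P - 1) * (a + b) powr 1"
      using ab by (simp add: mult.assoc powr_add[symmetric] distrib_left)
    also have "\<dots> = (a + b) powr P"
      by (subst powr_add[symmetric]) simp
    finally show ?thesis
      using ab p False by (simp add: Lnorm_le_iff P_def del: ennreal_plus)
  qed
  show ?thesis
  proof (cases "Lnorm p M f = \<infinity> \<or> Lnorm p M g = \<infinity>")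
    case True then show ?thesis by auto
  next
    case False
    then obtain a b where ab: "Lnorm p M f = ennreal a" "Lnorm p M g = ennreal b" "0 \<le> a" "0 \<le> b"
      by (cases "Lnorm p M f"; cases "Lnorm p M g") auto
    have "Lnorm p M (\<lambda>x. f x + g x) \<le> ennreal (a + b) + ennreal e" if "e > 0" for e
    proof -
      have "Lnorm p M (\<lambda>x. f x + g x) \<le> ennreal ((a + e / 2) + (b + e / 2))"
        using ab that by (intro pos) (auto intro!: ennreal_leI)
      also have "(a + e / 2) + (b + e / 2) = (a + b) + e" by simp
      also have "ennreal \<dots> = ennreal (a + b) + ennreal e"
        using ab that by (intro ennreal_plus) auto
      finally show ?thesis .
    qed
    then have "Lnorm p M (\<lambda>x. f x + g x) \<le> ennreal (a + b)"
      by (rule ennreal_le_epsilon)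
    then show ?thesis using ab by simp
  qed
qed

lemma Lnorm_cmult_le:
  assumes p: "1 \<le> p" and [measurable]: "f \<in> borel_measurable M" and "0 \<le> c"
  shows "Lnorm p M (\<lambda>x. ennreal c * f x) \<le> ennreal c * Lnorm p M f"
proof (cases "p = \<infinity>")
  case True
  have "AE x in M. ennreal c * f x \<le> ennreal c * esssup M f"
    using esssup_AE[where M = M and f = f] by eventually_elim (auto intro: mult_left_mono)
  then show ?thesis using True by (auto simp: Lnorm_def)
next
  case False
  define P where "P = enn2real p"
  have P: "1 \<le> P" using one_le_enn2real[OF p False] by (simp add: P_def)
  show ?thesis
  proof (cases "c = 0")
    case True
    then show ?thesis using P False by (simp add: Lnorm_def P_def[symmetric] epowr_def)
  next
    case c: False
    have "Lnorm p M (\<lambda>x. ennreal c * f x) = epowr (ennreal (c powr P) * (\<integral>\<^sup>+x. epowr (f x) P \<partial>M)) (1 / P)"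
      using P False c assms by (simp add: Lnorm_def P_def[symmetric] epowr_cmult nn_integral_cmult)
    also have "\<dots> = ennreal c * Lnorm p M f"
      using P False c assms by (simp add: Lnorm_def P_def[symmetric] epowr_cmult powr_powr)
    finally show ?thesis by simp
  qed
qed

text \<open>
  An increasing bijection carries strict lower bounds to strict lower bounds, and these determine
  a lower limit.
\<close>

lemma epowr_liminf_le:
  assumes "0 < p"
  shows "epowr (liminf f) p \<le> liminf (\<lambda>n. epowr (f n) p)"
  unfolding le_Liminf_iff
proof safe
  fix y assume y: "y < epowr (liminf f) p"
  have "epowr y (1 / p) < liminf f"
    using y assms epowr_mono[of "liminf f" "epowr y (1 / p)" p] 
    by (force simp: epowr_inverse' not_le[symmetric])
  then have "\<forall>\<^sub>F n in sequentially. epowr y (1 / p) < f n"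
    using le_Liminf_iff[of "liminf f" sequentially f] by simp
  then show "\<forall>\<^sub>F n in sequentially. y < epowr (f n) p"
  proof eventually_elim
    case (elim n)
    then show ?case
      using assms epowr_mono[of "epowr (f n) p" y "1 / p"]
      by (force simp: epowr_inverse not_le[symmetric])
  qed
qed

text \<open>
  Fatou's lemma; for \<open>p = \<infinity>\<close> it holds because the exceptional null sets of countably many essential
  suprema can be merged into one.
\<close>

lemma Lnorm_liminf_le:
  assumes p: "1 \<le> p" and [measurable]: "\<And>n. f n \<in> borel_measurable M"
  shows "Lnorm p M (\<lambda>x. liminf (\<lambda>n. f n x)) \<le> liminf (\<lambda>n. Lnorm p M (f n))"
proof (cases "p = \<infinity>")
  case True
  have "AE x in M. \<forall>n. f n x \<le> esssup M (f n)"
    by (simp add: AE_all_countable esssup_AE)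
  then have "AE x in M. liminf (\<lambda>n. f n x) \<le> liminf (\<lambda>n. esssup M (f n))"
    by eventually_elim (auto intro!: Liminf_mono)
  then show ?thesis using True by (auto simp: Lnorm_def)
next
  case False
  define P where "P = enn2real p"
  have P: "1 \<le> P" using one_le_enn2real[OF p False] by (simp add: P_def)
  have "(\<integral>\<^sup>+x. epowr (liminf (\<lambda>n. f n x)) P \<partial>M) \<le> (\<integral>\<^sup>+x. liminf (\<lambda>n. epowr (f n x) P) \<partial>M)"
    using P by (intro nn_integral_mono epowr_liminf_le) auto
  also have "\<dots> \<le> liminf (\<lambda>n. \<integral>\<^sup>+x. epowr (f n x) P \<partial>M)"
    by (intro nn_integral_liminf) auto
  finally have "epowr (\<integral>\<^sup>+x. epowr (liminf (\<lambda>n. f n x)) P \<partial>M) (1 / P)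
      \<le> epowr (liminf (\<lambda>n. \<integral>\<^sup>+x. epowr (f n x) P \<partial>M)) (1 / P)"
    using P by (intro epowr_mono) auto
  also have "\<dots> \<le> liminf (\<lambda>n. epowr (\<integral>\<^sup>+x. epowr (f n x) P \<partial>M) (1 / P))"
    using P by (intro epowr_liminf_le) auto
  finally show ?thesis using False by (simp add: Lnorm_def P_def)
qed

text \<open>
  The outer norm of a mixed norm is meaningful only if the inner one is measurable in the remaining
  variable. For \<open>p = \<infinity>\<close>, the essential supremum exceeds \<open>c\<close> exactly where the section of
  \<open>{f > c}\<close> has positive measure, and the measure of a section is measurable by Tonelli's theorem.
\<close>

lemma measurable_Lnorm:
  assumes "sigma_finite_measure M"
    and [measurable]: "(\<lambda>(y, x). f y x) \<in> borel_measurable (N \<Otimes>\<^sub>M M)"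
  shows "(\<lambda>y. Lnorm p M (f y)) \<in> borel_measurable N"
proof -
  interpret sigma_finite_measure M by fact
  show ?thesis
  proof (cases "p = \<infinity>")
    case True
    have "(\<lambda>y. esssup M (f y)) \<in> borel_measurable N"
    proof (rule borel_measurableI_greater)
      fix c :: ennreal
      have *: "c < esssup M (f y) \<longleftrightarrow> (\<integral>\<^sup>+x. (if c < f y x then 1 else 0) \<partial>M) \<noteq> 0" if "y \<in> space N" for y
      proof -
        have [measurable]: "f y \<in> borel_measurable M" using that by measurable
        have "c < esssup M (f y) \<longleftrightarrow> \<not> (AE x in M. f y x \<le> c)"
        proof
          assume "c < esssup M (f y)"
          then show "\<not> (AE x in M. f y x \<le> c)"
            using esssup_I[of "f y" M c] by (metis (no_types, lifting) \<open>f y \<in> borel_measurable M\<close> leD)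
        next
          assume *: "\<not> (AE x in M. f y x \<le> c)"
          show "c < esssup M (f y)"
          proof (rule ccontr)
            assume "\<not> c < esssup M (f y)"
            then have "esssup M (f y) \<le> c" by simp
            with esssup_AE[where M = M and f = "f y"] have "AE x in M. f y x \<le> c"
              by (auto elim!: eventually_mono intro: order_trans)
            with * show False by simp
          qed
        qed
        also have "\<dots> \<longleftrightarrow> \<not> (AE x in M. (if c < f y x then 1 else 0::ennreal) = 0)"
          by (simp add: not_less)
        also have "\<dots> \<longleftrightarrow> (\<integral>\<^sup>+x. (if c < f y x then 1 else 0) \<partial>M) \<noteq> 0"
          by (subst nn_integral_0_iff_AE) auto
        finally show ?thesis .
      qed
      have "(\<lambda>y. \<integral>\<^sup>+x. (if c < f y x then 1 else 0) \<partial>M) \<in> borel_measurable N"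
        by measurable
      then have "{y \<in> space N. (\<integral>\<^sup>+x. (if c < f y x then 1 else 0) \<partial>M) \<noteq> (0::ennreal)} \<in> sets N"
        by measurable
      also have "{y \<in> space N. (\<integral>\<^sup>+x. (if c < f y x then 1 else 0) \<partial>M) \<noteq> (0::ennreal)}
          = {y \<in> space N. c < esssup M (f y)}"
        using * by blast
      finally show "{y \<in> space N. c < esssup M (f y)} \<in> sets N" .
    qed
    then show ?thesis using True by (simp add: Lnorm_def)
  next
    case False
    then show ?thesis unfolding Lnorm_def by simp
  qed
qed

section \<open>The spherical Besov norm as a lower semicontinuous seminorm\<close>

lemma Delta_add: "Delta k (\<lambda>s. F s + G s) r = Delta k F r + Delta k G r"
  by (induction k arbitrary: r) (simp_all add: algebra_simps)

lemma Delta_cmult: "Delta k (\<lambda>s. c * F s) r = c * Delta k F r"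
  by (induction k arbitrary: r) (simp_all add: algebra_simps)

lemma Delta_tendsto:
  assumes "\<And>s. (\<lambda>n. F n s) \<longlonglongrightarrow> G s"
  shows "(\<lambda>n. Delta k (F n) r) \<longlonglongrightarrow> Delta k G r"
  by (induction k arbitrary: r) (auto intro!: tendsto_intros assms)

lemma measurable_Delta:
  assumes F: "(\<lambda>(y, r). F r y) \<in> borel_measurable (N \<Otimes>\<^sub>M borel)"
  shows "(\<lambda>(y, r). Delta k (\<lambda>s. F s y) r) \<in> borel_measurable (N \<Otimes>\<^sub>M borel)"
proof (induction k)
  have half: "(\<lambda>(y, r::real). (y, r / 2)) \<in> N \<Otimes>\<^sub>M borel \<rightarrow>\<^sub>M N \<Otimes>\<^sub>M borel"
    by measurable
  {
    case 0
    show ?case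
      using F measurable_compose[OF half F] by (simp add: split_beta)
  next
    case (Suc k)
    show ?case
      using Suc measurable_compose[OF half Suc] by (simp add: split_beta)
  }
qed

text \<open>
  Joint measurability in centre and radius is what Tonelli's theorem requires of the function
  under the mixed norm.
\<close>

definition ball_measurable :: "('a::euclidean_space set \<Rightarrow> real) \<Rightarrow> bool" where
  "ball_measurable \<nu> \<longleftrightarrow> (\<lambda>(y, r). ball_mass \<nu> r y) \<in> borel_measurable (borel \<Otimes>\<^sub>M borel)"

lemma sigma_finite_dr_over_r: "sigma_finite_measure dr_over_r"
  unfolding dr_over_r_def by (subst sigma_finite_measure.sigma_finite_iff_density_finite[OF lborel.sigma_finite_measure_axioms]) auto

lemma sets_dr_over_r [measurable_cong, simp]: "sets dr_over_r = sets borel"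
  by (simp add: dr_over_r_def)

text \<open>
  The function of centre and radius whose mixed norm is the Besov norm.
\<close>

definition SBE_density :: "real \<Rightarrow> ('a::euclidean_space set \<Rightarrow> real) \<Rightarrow> 'a \<Rightarrow> real \<Rightarrow> real" where
  "SBE_density \<alpha> \<nu> y r = r powr (- \<alpha> - real DIM('a))
     * Delta (nat \<lceil>\<alpha> + real DIM('a) - 1\<rceil>) (\<lambda>s. ball_mass \<nu> s y) r"

lemma SBE_norm_eq: "SBE_norm \<alpha> p q \<nu>
    = Lnorm q lborel (\<lambda>y. Lnorm p dr_over_r (\<lambda>r. ennreal \<bar>SBE_density \<alpha> \<nu> y r\<bar>))"
  by (simp add: SBE_norm_def SBE_density_def Let_def)

context
  fixes \<nu> :: "'a::euclidean_space set \<Rightarrow> real"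
  assumes \<nu>: "ball_measurable \<nu>"
begin

lemma measurable_SBE_density:
  "(\<lambda>(y, r). SBE_density \<alpha> \<nu> y r) \<in> borel_measurable (borel \<Otimes>\<^sub>M borel)"
  using measurable_Delta[OF \<nu>[unfolded ball_measurable_def]]
  unfolding SBE_density_def split_beta by measurable

lemma measurable_SBE_density_radius:
  "(\<lambda>r. ennreal \<bar>SBE_density \<alpha> \<nu> y r\<bar>) \<in> borel_measurable dr_over_r"
  using measurable_compose[OF measurable_Pair1' measurable_SBE_density, of y \<alpha>] by simp

lemma measurable_SBE_density_norm:
  "(\<lambda>y. Lnorm p dr_over_r (\<lambda>r. ennreal \<bar>SBE_density \<alpha> \<nu> y r\<bar>)) \<in> borel_measurable lborel"
proof (rule measurable_Lnorm[OF sigma_finite_dr_over_r])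
  have "(\<lambda>(y, r). ennreal \<bar>SBE_density \<alpha> \<nu> y r\<bar>) \<in> borel_measurable (borel \<Otimes>\<^sub>M borel)"
    using measurable_SBE_density[of \<alpha>] unfolding split_beta by measurable
  then show "(\<lambda>(y, r). ennreal \<bar>SBE_density \<alpha> \<nu> y r\<bar>)
      \<in> borel_measurable (lborel \<Otimes>\<^sub>M dr_over_r)"
    by (simp cong: measurable_cong_sets sets_pair_measure_cong)
qed

end

lemma ball_mass_arg_borel: "{x::'a::euclidean_space. dist x y \<le> r} \<in> sets borel"
  by measurable

lemma SBE_norm_cong:
  assumes "\<And>B. B \<in> sets borel \<Longrightarrow> \<nu> B = \<nu>' B"
  shows "SBE_norm \<alpha> p q \<nu> = SBE_norm \<alpha> p q \<nu>'"
  by (simp add: SBE_norm_def ball_mass_def assms ball_mass_arg_borel)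

lemma SBE_norm_add_le:
  assumes p: "1 \<le> p" and q: "1 \<le> q" and \<nu>: "ball_measurable \<nu>" and \<nu>': "ball_measurable \<nu>'"
  shows "SBE_norm \<alpha> p q (\<lambda>A. \<nu> A + \<nu>' A) \<le> SBE_norm \<alpha> p q \<nu> + SBE_norm \<alpha> p q \<nu>'"
proof -
  let ?\<mu> = "\<lambda>A. \<nu> A + \<nu>' A"
  have \<mu>: "ball_measurable ?\<mu>"
    using \<nu> \<nu>' by (simp add: ball_measurable_def ball_mass_def split_beta)
  have dens: "SBE_density \<alpha> ?\<mu> y r = SBE_density \<alpha> \<nu> y r + SBE_density \<alpha> \<nu>' y r" for y r
    by (simp add: SBE_density_def ball_mass_def Delta_add distrib_left)
  have "Lnorm p dr_over_r (\<lambda>r. ennreal \<bar>SBE_density \<alpha> ?\<mu> y r\<bar>)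
      \<le> Lnorm p dr_over_r (\<lambda>r. ennreal \<bar>SBE_density \<alpha> \<nu> y r\<bar>)
        + Lnorm p dr_over_r (\<lambda>r. ennreal \<bar>SBE_density \<alpha> \<nu>' y r\<bar>)" for y
  proof -
    have "Lnorm p dr_over_r (\<lambda>r. ennreal \<bar>SBE_density \<alpha> ?\<mu> y r\<bar>)
      \<le> Lnorm p dr_over_r (\<lambda>r. ennreal \<bar>SBE_density \<alpha> \<nu> y r\<bar> + ennreal \<bar>SBE_density \<alpha> \<nu>' y r\<bar>)"
      by (intro Lnorm_mono p measurable_SBE_density_radius \<mu>)
        (auto simp: dens simp flip: ennreal_plus intro!: ennreal_leI)
    also note Lnorm_add_le[OF p measurable_SBE_density_radius[OF \<nu>] measurable_SBE_density_radius[OF \<nu>']]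
    finally show ?thesis .
  qed
  then have "SBE_norm \<alpha> p q ?\<mu>
      \<le> Lnorm q lborel (\<lambda>y. Lnorm p dr_over_r (\<lambda>r. ennreal \<bar>SBE_density \<alpha> \<nu> y r\<bar>)
        + Lnorm p dr_over_r (\<lambda>r. ennreal \<bar>SBE_density \<alpha> \<nu>' y r\<bar>))"
    unfolding SBE_norm_eq by (intro Lnorm_mono q measurable_SBE_density_norm \<mu>)
  also note Lnorm_add_le[OF q measurable_SBE_density_norm[OF \<nu>] measurable_SBE_density_norm[OF \<nu>']]
  finally show ?thesis
    unfolding SBE_norm_eq .
qed

lemma SBE_norm_cmult_le:
  assumes p: "1 \<le> p" and q: "1 \<le> q" and \<nu>: "ball_measurable \<nu>"
  shows "SBE_norm \<alpha> p q (\<lambda>A. c * \<nu> A) \<le> ennreal \<bar>c\<bar> * SBE_norm \<alpha> p q \<nu>"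
proof -
  have \<mu>: "ball_measurable (\<lambda>A. c * \<nu> A)"
    using \<nu> by (simp add: ball_measurable_def ball_mass_def split_beta)
  have dens: "ennreal \<bar>SBE_density \<alpha> (\<lambda>A. c * \<nu> A) y r\<bar>
      = ennreal \<bar>c\<bar> * ennreal \<bar>SBE_density \<alpha> \<nu> y r\<bar>" for y r
    by (simp add: SBE_density_def ball_mass_def Delta_cmult abs_mult flip: ennreal_mult)
  have "SBE_norm \<alpha> p q (\<lambda>A. c * \<nu> A)
      \<le> Lnorm q lborel (\<lambda>y. ennreal \<bar>c\<bar> * Lnorm p dr_over_r (\<lambda>r. ennreal \<bar>SBE_density \<alpha> \<nu> y r\<bar>))"
    unfolding SBE_norm_eq
    apply (intro Lnorm_mono q measurable_SBE_density_norm \<mu>)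
    unfolding dens by (intro Lnorm_cmult_le p measurable_SBE_density_radius \<nu>) simp
  also have "\<dots> \<le> ennreal \<bar>c\<bar> * SBE_norm \<alpha> p q \<nu>"
    unfolding SBE_norm_eq by (intro Lnorm_cmult_le q measurable_SBE_density_norm \<nu>) simp
  finally show ?thesis .
qed

text \<open>
  Convergence on Borel sets implies pointwise convergence of the densities, because an iterated
  difference involves only finitely many balls; Fatou's lemma then applies first in the radius and
  then in the centre.
\<close>

lemma SBE_norm_le_limit:
  assumes p: "1 \<le> p" and q: "1 \<le> q"
    and \<nu>: "ball_measurable \<nu>" and \<nu>s: "\<And>n. ball_measurable (\<nu>s n)"
    and lim: "\<And>B. B \<in> sets borel \<Longrightarrow> (\<lambda>n. \<nu>s n B) \<longlonglongrightarrow> \<nu> B"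
    and le: "\<And>n. SBE_norm \<alpha> p q (\<nu>s n) \<le> C"
  shows "SBE_norm \<alpha> p q \<nu> \<le> C"
proof -
  have dens: "(\<lambda>r. ennreal \<bar>SBE_density \<alpha> \<nu> y r\<bar>)
      = (\<lambda>r. liminf (\<lambda>n. ennreal \<bar>SBE_density \<alpha> (\<nu>s n) y r\<bar>))" for y
  proof
    fix r
    have "(\<lambda>n. ennreal \<bar>SBE_density \<alpha> (\<nu>s n) y r\<bar>) \<longlonglongrightarrow> ennreal \<bar>SBE_density \<alpha> \<nu> y r\<bar>"
      unfolding SBE_density_def ball_mass_def
      by (intro tendsto_intros tendsto_ennrealI Delta_tendsto lim ball_mass_arg_borel)
    then show "ennreal \<bar>SBE_density \<alpha> \<nu> y r\<bar> = liminf (\<lambda>n. ennreal \<bar>SBE_density \<alpha> (\<nu>s n) y r\<bar>)"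
      by (metis lim_imp_Liminf sequentially_bot)
  qed
  have "SBE_norm \<alpha> p q \<nu>
      \<le> Lnorm q lborel (\<lambda>y. liminf (\<lambda>n. Lnorm p dr_over_r (\<lambda>r. ennreal \<bar>SBE_density \<alpha> (\<nu>s n) y r\<bar>)))"
    unfolding SBE_norm_eq
    apply (intro Lnorm_mono q measurable_SBE_density_norm \<nu>)
    unfolding dens by (intro Lnorm_liminf_le p measurable_SBE_density_radius \<nu>s)
  also have "\<dots> \<le> liminf (\<lambda>n. SBE_norm \<alpha> p q (\<nu>s n))"
    unfolding SBE_norm_eq by (intro Lnorm_liminf_le q measurable_SBE_density_norm \<nu>s)
  also have "\<dots> \<le> liminf (\<lambda>n::nat. C)"
    by (intro Liminf_mono always_eventually allI le)
  also have "\<dots> = C"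
    by (simp add: Liminf_const)
  finally show ?thesis .
qed

text \<open>
  The image under \<open>X\<close> of the signed measure with density \<open>h\<close>. It is linear in \<open>h\<close>, so that
  differences and Riemann sums of occupation measures can be handled as scalar functions of time.
\<close>

definition weighted_image ::
    "'b measure \<Rightarrow> ('b \<Rightarrow> 'a) \<Rightarrow> ('b \<Rightarrow> real) \<Rightarrow> 'a set \<Rightarrow> real" where
  "weighted_image M X h A = (LINT u|M. h u * indicator A (X u))"

lemma ball_measurable_weighted_image:
  assumes "sigma_finite_measure M" and [measurable]: "X \<in> borel_measurable M" "h \<in> borel_measurable M"
  shows "ball_measurable (weighted_image M X h :: 'a::euclidean_space set \<Rightarrow> real)"
proof -
  interpret sigma_finite_measure M by fact
  have *: "(\<lambda>(z, u). h u * (if dist (X u) (fst z) \<le> snd z then 1 else 0))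
      \<in> borel_measurable ((borel \<Otimes>\<^sub>M borel) \<Otimes>\<^sub>M M)"
    by measurable
  show ?thesis
    unfolding ball_measurable_def ball_mass_def weighted_image_def
    using borel_measurable_lebesgue_integral[OF *] by (simp add: split_beta indicator_def)
qed

lemma integrable_weight_indicator:
  assumes "integrable M h" "X \<in> borel_measurable M" "A \<in> sets borel"
  shows "integrable M (\<lambda>u. h u * indicator A (X u) :: real)"
proof (rule Bochner_Integration.integrable_bound[OF assms(1)])
  show "(\<lambda>u. h u * indicator A (X u)) \<in> borel_measurable M"
    using assms by measurable
qed (auto simp: indicator_def)

lemma weighted_image_add:
  assumes "integrable M h" "integrable M k" "X \<in> borel_measurable M" "A \<in> sets borel"
  shows "weighted_image M X (\<lambda>u. h u + k u) A = weighted_image M X h A + weighted_image M X k A"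
  using assms by (simp add: weighted_image_def distrib_right integrable_weight_indicator)

lemma weighted_image_cmult:
  "weighted_image M X (\<lambda>u. c * h u) A = c * weighted_image M X h A"
  by (simp add: weighted_image_def mult.assoc)

lemma weighted_image_tendsto:
  assumes [measurable]: "X \<in> borel_measurable M" "\<And>n. h n \<in> borel_measurable M" "g \<in> borel_measurable M"
    "A \<in> sets borel"
    and "AE u in M. (\<lambda>n. h n u) \<longlonglongrightarrow> g u" "integrable M w" "\<And>n. AE u in M. \<bar>h n u\<bar> \<le> w u"
  shows "(\<lambda>n. weighted_image M X (h n) A) \<longlonglongrightarrow> weighted_image M X g A"
  unfolding weighted_image_def
proof (rule integral_dominated_convergence[where w = w])
  show "AE u in M. (\<lambda>n. h n u * indicator A (X u)) \<longlonglongrightarrow> g u * indicator A (X u)"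
    using assms(5) by eventually_elim (auto intro!: tendsto_intros)
  show "AE u in M. norm (h n u * indicator A (X u)) \<le> w u" for n
    using assms(7)[of n] by eventually_elim (auto simp: indicator_def)
qed (use assms in auto)

section \<open>Controls\<close>

lemma step_mono_le:
  fixes u :: "nat \<Rightarrow> 'a::preorder"
  assumes "\<And>i. i < n \<Longrightarrow> u i \<le> u (Suc i)" "i \<le> j" "j \<le> n"
  shows "u i \<le> u j"
  using assms(2,3)
proof (induction j rule: dec_induct)
  case (step j)
  then show ?case
    using assms(1)[of j] by (auto intro: order_trans)
qed simp

lemma interval_partition_mono:
  assumes "interval_partition a b n t" "i \<le> j" "j \<le> n"
  shows "t i \<le> t j"
  by (rule step_mono_le[OF _ assms(2,3)]) (use assms(1) in \<open>simp add: interval_partition_def less_imp_le\<close>)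

lemma interval_partition_range:
  assumes "interval_partition a b n t" "h \<le> n"
  shows "t h \<in> {a..b}"
  using interval_partition_mono[OF assms(1), of 0 h] interval_partition_mono[OF assms(1), of h n] assms
  by (auto simp: interval_partition_def)

text \<open>
  The control at \<open>t\<close> is the supremum of the variation sums over partitions of \<open>[a, t]\<close>: appending
  the point \<open>t\<close> to a partition of \<open>[a, s]\<close> shows that it grows by at least the \<open>p\<close>-th power of the
  increment over \<open>[s, t]\<close>.
\<close>

lemma finite_variation_space_control:
  assumes f: "f \<in> finite_variation_space p a b E N" and "0 < p"
  obtains W where "mono_on {a..b} W"
    "\<And>s t. a \<le> s \<Longrightarrow> s < t \<Longrightarrow> t \<le> b \<Longrightarrow> N (f t - f s) \<le> ennreal ((W t - W s) powr (1 / p))"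
proof -
  define S where "S n u = (\<Sum>h=1..n::nat. epowr (N (f (u h) - f (u (h - 1)))) p)" for n u
  define v where "v t = (SUP (n, u) \<in> {(n, u). interval_partition a t n u}. S n u)" for t
  have step: "v s + epowr (N (f t - f s)) p \<le> v t" if "a \<le> s" "s < t" for s t
  proof -
    let ?I = "{(n, u). interval_partition a s n u}"
    have ne: "?I \<noteq> {}"
    proof (cases "a = s")
      case True
      then have "(0, \<lambda>_. a) \<in> ?I" by (simp add: interval_partition_def)
      then show ?thesis by blast
    next
      case False
      then have "(Suc 0, \<lambda>i. if i = 0 then a else s) \<in> ?I" 
        using that by (simp add: interval_partition_def)
      then show ?thesis by blast
    qed
    have "v s + epowr (N (f t - f s)) p = (SUP (n, u) \<in> ?I. S n u + epowr (N (f t - f s)) p)"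
      unfolding v_def using ennreal_SUP_add_left[OF ne, of "\<lambda>(n, u). S n u" "epowr (N (f t - f s)) p"]
      by (simp add: split_beta)
    also have "\<dots> \<le> v t"
    proof (rule SUP_least, safe)
      fix n u assume u: "interval_partition a s n u"
      let ?u = "u(Suc n := t)"
      have "interval_partition a t (Suc n) ?u"
        using u that by (auto simp: interval_partition_def less_Suc_eq)
      then have "S (Suc n) ?u \<le> v t"
        unfolding v_def by (intro SUP_upper2[of "(Suc n, ?u)"]) auto
      moreover have "S n ?u = S n u"
        unfolding S_def by (intro sum.cong) auto
      then have "S (Suc n) ?u = S n u + epowr (N (f t - f s)) p"
        using u by (simp add: S_def interval_partition_def)
      ultimately show "S n u + epowr (N (f t - f s)) p \<le> v t" by simp
    qed
    finally show ?thesis .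
  qed
  have vb: "v b < \<infinity>"
    using f by (simp add: finite_variation_space_def v_def S_def)
  have fin: "v t < \<infinity>" if "a \<le> t" "t \<le> b" for t
  proof (cases "t = b")
    case False
    then have "v t \<le> v b"
      using step[of t b] that by (auto intro: order_trans[OF add_increasing2])
    then show ?thesis using vb by simp
  qed (use vb in simp)
  have le: "epowr (N (f t - f s)) p \<le> ennreal (enn2real (v t) - enn2real (v s)) \<and> 
      enn2real (v s) \<le> enn2real (v t)"
    if ab: "a \<le> s" "s < t" "t \<le> b" for s t
  proof -
    obtain x y where xy: "v s = ennreal x" "v t = ennreal y" "0 \<le> x" "0 \<le> y"
      using fin[of s] fin[of t] ab by (cases "v s"; cases "v t") auto
    have st: "v s + epowr (N (f t - f s)) p \<le> v t" using step ab by simp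
    then have "epowr (N (f t - f s)) p < \<infinity>" using xy
      by (cases "epowr (N (f t - f s)) p") (auto simp: top_unique)
    then obtain z where z: "epowr (N (f t - f s)) p = ennreal z" "0 \<le> z"
      by (cases "epowr (N (f t - f s)) p") auto
    show ?thesis using st xy z by (auto simp flip: ennreal_plus intro!: ennreal_leI)
  qed
  show thesis
  proof (rule that[of "\<lambda>t. enn2real (v t)"])
    show "mono_on {a..b} (\<lambda>t. enn2real (v t))"
      by (rule mono_onI) (metis atLeastAtMost_iff le order_le_less)
    show "N (f t - f s) \<le> ennreal ((enn2real (v t) - enn2real (v s)) powr (1 / p))"
      if "a \<le> s" "s < t" "t \<le> b" for s t
      using le[OF that] \<open>0 < p\<close> by (intro epowr_le_iff'[THEN iffD1]) auto
  qed
qed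

text \<open>
  The converse direction: the \<open>p\<close>-th powers of the bounds telescope along a partition.
\<close>

lemma finite_variation_spaceI:
  assumes "0 < p" and "0 \<le> C" and W: "mono_on {a..b} W" and E: "\<And>t. t \<in> {a..b} \<Longrightarrow> f t \<in> E"
    and le: "\<And>s t. a \<le> s \<Longrightarrow> s < t \<Longrightarrow> t \<le> b \<Longrightarrow> N (f t - f s) \<le> ennreal (C * (W t - W s) powr (1 / p))"
  shows "f \<in> finite_variation_space p a b E N"
proof -
  have "(\<Sum>h=1..n. epowr (N (f (t h) - f (t (h - 1)))) p) \<le> ennreal (C powr p * (W b - W a))"
    if t: "interval_partition a b n t" for n t
  proof -
    have "epowr (N (f (t h) - f (t (h - 1)))) p \<le> ennreal (C powr p * (W (t h) - W (t (h - 1))))"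
      if h: "h \<in> {1..n}" for h
    proof -
      have pts: "a \<le> t (h - 1)" "t (h - 1) < t h" "t h \<le> b"
        using interval_partition_range[OF t, of "h - 1"] interval_partition_range[OF t, of h] h
          t[unfolded interval_partition_def] Suc_le_D[of 0 h] by auto
      have W': "0 \<le> W (t h) - W (t (h - 1))"
        using mono_onD[OF W, of "t (h - 1)" "t h"] pts by simp
      then have "C * (W (t h) - W (t (h - 1))) powr (1 / p)
          = (C powr p * (W (t h) - W (t (h - 1)))) powr (1 / p)"
        using assms by (simp add: powr_mult powr_powr)
      then show ?thesis
        using le[OF pts] W' assms by (simp add: epowr_le_iff')
    qed
    then have "(\<Sum>h=1..n. epowr (N (f (t h) - f (t (h - 1)))) p)
        \<le> (\<Sum>h=1..n. ennreal (C powr p * (W (t h) - W (t (h - 1)))))"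
      by (rule sum_mono)
    also have "\<dots> = ennreal (\<Sum>h=1..n. C powr p * (W (t h) - W (t (h - 1))))"
    proof (rule sum_ennreal)
      fix h assume "h \<in> {1..n}"
      then have "h - 1 \<le> n" "h \<le> n" "h - 1 \<le> h" by auto
      then show "0 \<le> C powr p * (W (t h) - W (t (h - 1)))"
        using mono_onD[OF W interval_partition_range[OF t] interval_partition_range[OF t] interval_partition_mono[OF t], of "h - 1" h]
        by (intro mult_nonneg_nonneg) auto
    qed
    also have "(\<Sum>h=1..n. C powr p * (W (t h) - W (t (h - 1)))) = C powr p * (W b - W a)"
      using sum_telescope''[of 0 n "\<lambda>h. W (t h)"] t
      by (simp add: sum_distrib_left[symmetric] interval_partition_def atLeastSucAtMost_greaterThanAtMost)
    finally show ?thesis .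
  qed
  then have "(SUP (n, t) \<in> {(n, t). interval_partition a b n t}.
            \<Sum>h=1..n. epowr (N (f (t h) - f (t (h - 1)))) p) \<le> ennreal (C powr p * (W b - W a))"
    by (intro SUP_least) auto
  also have "\<dots> < \<infinity>" by simp
  finally show ?thesis using E by (simp add: finite_variation_space_def)
qed

section \<open>Young's inequality for Riemann sums\<close>

text \<open>
  Deleting the partition point \<open>j + 1\<close> merges the terms \<open>j\<close> and \<open>j + 1\<close> and shifts the later ones.
\<close>

lemma sum_remove_point:
  fixes f f' :: "nat \<Rightarrow> 'a::ab_group_add"
  assumes "j \<le> n" "\<And>k. k < j \<Longrightarrow> f' k = f k" "\<And>k. j < k \<Longrightarrow> f' k = f (Suc k)"
  shows "(\<Sum>k\<le>Suc n. f k) = (\<Sum>k\<le>n. f' k) + (f j + f (Suc j) - f' j)"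
  using assms(1)
proof (induction n rule: dec_induct)
  case base
  have "(\<Sum>k<j. f' k) = (\<Sum>k<j. f k)"
    using assms(2) by simp
  then show ?case
    by (simp add: lessThan_Suc_atMost[symmetric])
next
  case (step n)
  then show ?case
    using assms(3)[of "Suc n"] by simp
qed

text \<open>
  The \<open>n + 1\<close> double steps cover every step at most twice, so they add up to at most twice the
  total growth, and one of them does not exceed the average.
\<close>

lemma ex_short_double_step:
  fixes w :: "nat \<Rightarrow> real"
  assumes mono: "\<And>i. i \<le> Suc n \<Longrightarrow> w i \<le> w (Suc i)"
  shows "\<exists>j\<le>n. w (Suc (Suc j)) - w j \<le> 2 * (w (Suc (Suc n)) - w 0) / real (Suc n)"
proof (rule ccontr)
  let ?\<delta> = "2 * (w (Suc (Suc n)) - w 0) / real (Suc n)"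
  assume "\<not> ?thesis"
  then have "?\<delta> < w (Suc (Suc j)) - w j" if "j \<le> n" for j
    using that by force
  then have "(\<Sum>j\<le>n. ?\<delta>) < (\<Sum>j\<le>n. w (Suc (Suc j)) - w j)"
    by (intro sum_strict_mono) auto
  moreover have "(\<Sum>j\<le>n. w (Suc (Suc j)) - w j) = (w (Suc (Suc n)) - w 1) + (w (Suc n) - w 0)"
    by (induction n) auto
  moreover have "w 0 \<le> w 1" "w (Suc n) \<le> w (Suc (Suc n))"
    using mono[of 0] mono[of "Suc n"] by auto
  ultimately show False by simp
qed

text \<open>
  The relation \<open>B h c\<close> stands for the statement that \<open>c\<close> bounds a seminorm of \<open>h\<close>. Only bounds
  occur, so the seminorm may take infinite values.
\<close>

context
  fixes B :: "(real \<Rightarrow> real) \<Rightarrow> real \<Rightarrow> bool" and G W m :: "real \<Rightarrow> real" and a b \<beta> \<gamma> K :: real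
  assumes B_add: "\<And>h k c d. B h c \<Longrightarrow> B k d \<Longrightarrow> B (\<lambda>x. h x + k x) (c + d)"
    and B_cmult: "\<And>h e c. B h c \<Longrightarrow> B (\<lambda>x. e * h x) (\<bar>e\<bar> * c)"
    and B_mono: "\<And>h c d. B h c \<Longrightarrow> c \<le> d \<Longrightarrow> B h d"
    and B_incr: "\<And>s t. a \<le> s \<Longrightarrow> s \<le> t \<Longrightarrow> t \<le> b
        \<Longrightarrow> B (\<lambda>x. m x * indicator {s<..t} x) ((W t - W s) powr \<beta>)"
    and W: "mono_on {a..b} W"
    and G: "\<And>s t. a \<le> s \<Longrightarrow> s \<le> t \<Longrightarrow> t \<le> b \<Longrightarrow> \<bar>G t - G s\<bar> \<le> K * (W t - W s) powr \<gamma>"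
    and nonneg: "0 \<le> K" "0 \<le> \<beta>" "0 \<le> \<gamma>"
begin

text \<open>
  Young's argument: delete one by one the interior points of the partition, each time the one whose
  two neighbouring intervals carry the least control. Deleting \<open>u\<^sub>j\<^sub>+\<^sub>1\<close> changes the sum by
  \<open>(G(u\<^sub>j\<^sub>+\<^sub>1) - G(u\<^sub>j)) m 1\<close> on the second of these intervals, and with \<open>k\<close> interior points left this
  costs at most \<open>K (2 w / k)\<^sup>\<beta>\<^sup>+\<^sup>\<gamma>\<close>.
\<close>

lemma young_sum_bound:
  assumes "\<And>i. i \<le> n \<Longrightarrow> u i \<le> u (Suc i)" "a \<le> u 0" "u (Suc n) \<le> b"
  shows "B (\<lambda>x. \<Sum>i\<le>n. (G (u i) - G (u 0)) * (m x * indicator {u i<..u (Suc i)} x))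
    (K * (\<Sum>k=1..n. (2 * (W (u (Suc n)) - W (u 0)) / real k) powr (\<beta> + \<gamma>)))"
  using assms
proof (induction n arbitrary: u)
  case 0
  then show ?case
    using B_cmult[OF B_incr[of "u 0" "u 1"], of 0] by simp
next
  case (Suc n)
  have le: "u i \<le> u j" if "i \<le> j" "j \<le> Suc (Suc n)" for i j
    by (rule step_mono_le[OF _ that]) (simp add: Suc.prems(1))
  have in_ab: "u i \<in> {a..b}" if "i \<le> Suc (Suc n)" for i
    using le[of 0 i] le[of i "Suc (Suc n)"] that Suc.prems by simp
  have W_le: "W (u i) \<le> W (u j)" if "i \<le> j" "j \<le> Suc (Suc n)" for i j
    using that le in_ab by (intro mono_onD[OF W]) auto
  define \<delta> where "\<delta> = 2 * (W (u (Suc (Suc n))) - W (u 0)) / real (Suc n)"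
  obtain j where j: "j \<le> n" "W (u (Suc (Suc j))) - W (u j) \<le> \<delta>"
    using ex_short_double_step[of n "\<lambda>i. W (u i)"] W_le by (auto simp: \<delta>_def)
  have \<delta>: "0 \<le> \<delta>"
    using W_le[of 0 "Suc (Suc n)"] by (simp add: \<delta>_def)
  define v where "v k = (if k \<le> j then u k else u (Suc k))" for k
  define f where "f x i = (G (u i) - G (u 0)) * (m x * indicator {u i<..u (Suc i)} x)" for x i
  define g where "g x i = (G (v i) - G (v 0)) * (m x * indicator {v i<..v (Suc i)} x)" for x i
  have "B (\<lambda>x. \<Sum>i\<le>n. g x i)
      (K * (\<Sum>k=1..n. (2 * (W (v (Suc n)) - W (v 0)) / real k) powr (\<beta> + \<gamma>)))"
    unfolding g_def using j Suc.prems le by (intro Suc.IH) (auto simp: v_def)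
  then have IH: "B (\<lambda>x. \<Sum>i\<le>n. g x i)
      (K * (\<Sum>k=1..n. (2 * (W (u (Suc (Suc n))) - W (u 0)) / real k) powr (\<beta> + \<gamma>)))"
    using j by (simp add: v_def)
  have "B (\<lambda>x. (G (u (Suc j)) - G (u j)) * (m x * indicator {u (Suc j)<..u (Suc (Suc j))} x))
      (\<bar>G (u (Suc j)) - G (u j)\<bar> * (W (u (Suc (Suc j))) - W (u (Suc j))) powr \<beta>)"
    using j le in_ab[of "Suc j"] in_ab[of "Suc (Suc j)"] by (intro B_cmult B_incr) auto
  moreover have "\<bar>G (u (Suc j)) - G (u j)\<bar> * (W (u (Suc (Suc j))) - W (u (Suc j))) powr \<beta>
      \<le> K * \<delta> powr (\<beta> + \<gamma>)"
  proof -
    have "\<bar>G (u (Suc j)) - G (u j)\<bar> \<le> K * (W (u (Suc j)) - W (u j)) powr \<gamma>"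
      using j le in_ab[of "Suc j"] in_ab[of j] by (intro G) auto
    also have "\<dots> \<le> K * \<delta> powr \<gamma>"
      using j W_le[of j "Suc j"] W_le[of "Suc j" "Suc (Suc j)"] nonneg
      by (intro mult_left_mono powr_mono2) auto
    finally have "\<bar>G (u (Suc j)) - G (u j)\<bar> \<le> K * \<delta> powr \<gamma>" .
    moreover have "(W (u (Suc (Suc j))) - W (u (Suc j))) powr \<beta> \<le> \<delta> powr \<beta>"
      using j W_le[of j "Suc j"] W_le[of "Suc j" "Suc (Suc j)"] nonneg
      by (intro powr_mono2) auto
    ultimately have "\<bar>G (u (Suc j)) - G (u j)\<bar> * (W (u (Suc (Suc j))) - W (u (Suc j))) powr \<beta>
        \<le> (K * \<delta> powr \<gamma>) * \<delta> powr \<beta>"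
      using nonneg by (intro mult_mono) auto
    then show ?thesis by (simp add: powr_add mult_ac)
  qed
  ultimately have "B (\<lambda>x. (G (u (Suc j)) - G (u j)) * (m x * indicator {u (Suc j)<..u (Suc (Suc j))} x))
      (K * \<delta> powr (\<beta> + \<gamma>))"
    by (rule B_mono)
  note B_add[OF IH this]
  moreover have "(\<Sum>i\<le>Suc n. f x i) = (\<Sum>i\<le>n. g x i)
      + (G (u (Suc j)) - G (u j)) * (m x * indicator {u (Suc j)<..u (Suc (Suc j))} x)" for x
  proof -
    have "u j \<le> u (Suc j)" "u (Suc j) \<le> u (Suc (Suc j))"
      using le j by auto
    then have split: "indicator {u j<..u (Suc (Suc j))} x
        = (indicator {u j<..u (Suc j)} x + indicator {u (Suc j)<..u (Suc (Suc j))} x :: real)"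
      by (auto simp: indicator_def)
    have "(\<Sum>i\<le>Suc n. f x i) = (\<Sum>i\<le>n. g x i) + (f x j + f x (Suc j) - g x j)"
      using j by (intro sum_remove_point) (auto simp: f_def g_def v_def)
    also have "f x j + f x (Suc j) - g x j
        = (G (u (Suc j)) - G (u j)) * (m x * indicator {u (Suc j)<..u (Suc (Suc j))} x)"
      by (simp add: f_def g_def v_def split algebra_simps)
    finally show ?thesis .
  qed
  ultimately show ?case
    by (simp add: f_def \<delta>_def distrib_left)
qed

text \<open>
  Because \<open>\<beta> + \<gamma> > 1\<close>, the costs of all deletions are summable, uniformly in the partition. The
  constant \<open>G(u\<^sub>0)\<close>, which is subtracted in the previous bound, multiplies a sum that telescopes to
  the single increment over the whole interval.
\<close>

lemma young_riemann_sum_bound: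
  assumes u: "\<And>i. i \<le> n \<Longrightarrow> u i \<le> u (Suc i)" "a \<le> u 0" "u (Suc n) \<le> b" and "1 < \<beta> + \<gamma>"
  defines "w \<equiv> W (u (Suc n)) - W (u 0)"
  shows "B (\<lambda>x. \<Sum>i\<le>n. G (u i) * (m x * indicator {u i<..u (Suc i)} x))
    (\<bar>G (u 0)\<bar> * w powr \<beta> + K * (2 * w) powr (\<beta> + \<gamma>) * (\<Sum>k. real k powr - (\<beta> + \<gamma>)))"
proof -
  have le: "u i \<le> u j" if "i \<le> j" "j \<le> Suc n" for i j
    by (rule step_mono_le[OF _ that]) (simp add: u(1))
  have w: "0 \<le> w"
    using mono_onD[OF W, of "u 0" "u (Suc n)"] le[of 0 "Suc n"] u by (auto simp: w_def)
  have summable: "summable (\<lambda>k. real k powr - (\<beta> + \<gamma>))"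
    using assms by (simp add: summable_real_powr_iff)
  have "(\<Sum>k=1..n. (2 * w / real k) powr (\<beta> + \<gamma>))
      = (2 * w) powr (\<beta> + \<gamma>) * (\<Sum>k=1..n. real k powr - (\<beta> + \<gamma>))"
  proof -
    have "(2 * w / real k) powr e = (2 * w) powr e * real k powr - e" for k e
      using w by (simp add: powr_divide powr_minus_divide)
    then show ?thesis by (simp only: sum_distrib_left)
  qed
  also have "\<dots> \<le> (2 * w) powr (\<beta> + \<gamma>) * (\<Sum>k. real k powr - (\<beta> + \<gamma>))"
    by (intro mult_left_mono sum_le_suminf summable) auto
  finally have "K * (\<Sum>k=1..n. (2 * w / real k) powr (\<beta> + \<gamma>))
      \<le> K * (2 * w) powr (\<beta> + \<gamma>) * (\<Sum>k. real k powr - (\<beta> + \<gamma>))"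
    using nonneg by (simp add: mult_left_mono mult.assoc)
  from B_mono[OF young_sum_bound[OF u, folded w_def] this]
  have "B (\<lambda>x. \<Sum>i\<le>n. (G (u i) - G (u 0)) * (m x * indicator {u i<..u (Suc i)} x))
      (K * (2 * w) powr (\<beta> + \<gamma>) * (\<Sum>k. real k powr - (\<beta> + \<gamma>)))" by simp
  moreover have "B (\<lambda>x. G (u 0) * (m x * indicator {u 0<..u (Suc n)} x)) (\<bar>G (u 0)\<bar> * w powr \<beta>)"
    unfolding w_def using u le by (intro B_cmult B_incr) auto
  ultimately have bound: "B (\<lambda>x. G (u 0) * (m x * indicator {u 0<..u (Suc n)} x)
      + (\<Sum>i\<le>n. (G (u i) - G (u 0)) * (m x * indicator {u i<..u (Suc i)} x)))
    (\<bar>G (u 0)\<bar> * w powr \<beta> + K * (2 * w) powr (\<beta> + \<gamma>) * (\<Sum>k. real k powr - (\<beta> + \<gamma>)))"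
    by (intro B_add)
  have cover: "indicator {u 0<..u (Suc n)} x = (\<Sum>i\<le>n. indicator {u i<..u (Suc i)} x :: real)" for x
    using le
  proof (induction n)
    case (Suc n)
    then have "indicator {u 0<..u (Suc n)} x = (\<Sum>i\<le>n. indicator {u i<..u (Suc i)} x :: real)"
      by simp
    moreover have "u 0 \<le> u (Suc n)" "u (Suc n) \<le> u (Suc (Suc n))"
      using Suc.prems by auto
    then have "indicator {u 0<..u (Suc (Suc n))} x
        = (indicator {u 0<..u (Suc n)} x + indicator {u (Suc n)<..u (Suc (Suc n))} x :: real)"
      by (auto simp: indicator_def)
    ultimately show ?case by simp
  qed simp
  have riemann: "G (u 0) * (m x * indicator {u 0<..u (Suc n)} x)
      + (\<Sum>i\<le>n. (G (u i) - G (u 0)) * (m x * indicator {u i<..u (Suc i)} x))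
      = (\<Sum>i\<le>n. G (u i) * (m x * indicator {u i<..u (Suc i)} x))" for x
    unfolding cover sum_distrib_left sum.distrib[symmetric]
    by (intro sum.cong) (simp_all add: left_diff_distrib)
  show ?thesis
    using bound unfolding riemann .
qed

end

section \<open>Change of variables along a bi-Lipschitz map\<close>

context
  fixes \<phi> \<phi>' :: "real \<Rightarrow> real" and a b c C :: real
  assumes ab: "a < b" and c: "0 < c"
    and bilip: "\<forall>x\<in>{a..b}. \<forall>y\<in>{a..b}. c * dist x y \<le> dist (\<phi> x) (\<phi> y) \<and> dist (\<phi> x) (\<phi> y) \<le> C * dist x y"
    and deriv: "AE t in lebesgue_on {a..b}. (\<phi> has_real_derivative \<phi>' t) (at t within {a..b})"
begin

lemma bilipschitz_lower: "x \<in> {a..b} \<Longrightarrow> y \<in> {a..b} \<Longrightarrow> c * \<bar>x - y\<bar> \<le> \<bar>\<phi> x - \<phi> y\<bar>"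
  and bilipschitz_upper: "x \<in> {a..b} \<Longrightarrow> y \<in> {a..b} \<Longrightarrow> \<bar>\<phi> x - \<phi> y\<bar> \<le> C * \<bar>x - y\<bar>"
  using bilip by (simp_all add: dist_real_def)

lemma bilipschitz_inj_on: "inj_on \<phi> {a..b}"
proof (rule inj_onI)
  fix x y assume "x \<in> {a..b}" "y \<in> {a..b}" "\<phi> x = \<phi> y"
  then have "c * \<bar>x - y\<bar> \<le> 0" using bilipschitz_lower[of x y] by simp
  then show "x = y" using c by (simp add: mult_le_0_iff)
qed

lemma bilipschitz_continuous_on: "continuous_on {a..b} \<phi>"
proof -
  have "C-lipschitz_on {a..b} \<phi>"
  proof (rule lipschitz_onI)
    have "0 \<le> C * \<bar>b - a\<bar>" using bilipschitz_upper[of b a] ab by (intro order_trans[OF abs_ge_zero]) auto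
    then show "0 \<le> C" using ab by (simp add: zero_le_mult_iff)
  qed (use bilipschitz_upper in \<open>simp add: dist_real_def\<close>)
  then show ?thesis by (rule lipschitz_on_continuous_on)
qed

lemma bilipschitz_image_segment:
  assumes "a \<le> s" "s \<le> t" "t \<le> b"
  shows "\<phi> ` {s..t} = closed_segment (\<phi> s) (\<phi> t)"
proof -
  have "closed_segment s t = {s..t}"
    using assms by (simp add: closed_segment_eq_real_ivl)
  moreover have "{s..t} \<subseteq> {a..b}" using assms by auto
  ultimately show ?thesis
    using continuous_injective_image_segment_1[of s t \<phi>]
      continuous_on_subset[OF bilipschitz_continuous_on] inj_on_subset[OF bilipschitz_inj_on] by metis
qed

text \<open>
  For \<open>s \<le> t\<close> the point \<open>\<phi> s\<close> lies between \<open>\<phi> a\<close> and \<open>\<phi> t\<close>, and \<open>\<phi> t\<close> lies between \<open>\<phi> a\<close> and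
  \<open>\<phi> b\<close>. The order of \<open>\<phi> a\<close> and \<open>\<phi> b\<close> therefore decides the order of \<open>\<phi> s\<close> and \<open>\<phi> t\<close>.
\<close>

lemma bilipschitz_monotone: "mono_on {a..b} \<phi> \<or> mono_on {a..b} (\<lambda>t. - \<phi> t)"
proof -
  have start: "\<phi> s \<in> closed_segment (\<phi> a) (\<phi> t)" if "a \<le> s" "s \<le> t" "t \<le> b" for s t
    using bilipschitz_image_segment[of a t] that by auto
  show ?thesis
  proof (cases "\<phi> a \<le> \<phi> b")
    case True
    have "\<phi> s \<le> \<phi> t" if st: "a \<le> s" "s \<le> t" "t \<le> b" for s t
      using start[OF st] start[of t b] st True by (auto simp: closed_segment_eq_real_ivl split: if_splits)
    then show ?thesis by (auto intro!: mono_onI)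
  next
    case False
    have "\<phi> t \<le> \<phi> s" if st: "a \<le> s" "s \<le> t" "t \<le> b" for s t
      using start[OF st] start[of t b] st False by (auto simp: closed_segment_eq_real_ivl split: if_splits)
    then show ?thesis by (auto intro!: mono_onI)
  qed
qed

lemma negligible_bilipschitz_image:
  assumes "negligible N" "N \<subseteq> {a..b}"
  shows "negligible (\<phi> ` N)"
proof (rule negligible_locally_Lipschitz_image)
  fix x assume "x \<in> N"
  then have "\<forall>y\<in>N \<inter> UNIV. norm (\<phi> y - \<phi> x) \<le> C * norm (y - x)"
    using bilipschitz_upper[of _ x] assms by (auto simp: subset_iff)
  then show "\<exists>T B. open T \<and> x \<in> T \<and> (\<forall>y\<in>N \<inter> T. norm (\<phi> y - \<phi> x) \<le> B * norm (y - x))"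
    by (intro exI[of _ UNIV] exI[of _ C]) auto
qed (use assms in auto)

definition diff_points :: "real set" where
  "diff_points = {t \<in> {a..b}. (\<phi> has_real_derivative \<phi>' t) (at t within {a..b})}"

lemma diff_points_subset: "diff_points \<subseteq> {a..b}"
  by (auto simp: diff_points_def)

lemma negligible_non_diff_points: "negligible ({a..b} - diff_points)"
proof -
  have "AE t in lebesgue. t \<in> {a..b} \<longrightarrow> (\<phi> has_real_derivative \<phi>' t) (at t within {a..b})"
    using deriv by (simp add: AE_restrict_space_iff)
  then obtain N where N: "N \<in> null_sets lebesgue"
    "\<And>t. t \<notin> N \<Longrightarrow> t \<in> {a..b} \<Longrightarrow> (\<phi> has_real_derivative \<phi>' t) (at t within {a..b})"
    by (auto elim!: AE_E3)
  then have "{a..b} - diff_points \<subseteq> N"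
    by (auto simp: diff_points_def)
  then show ?thesis
    using N by (metis negligible_iff_null_sets negligible_subset)
qed

lemma sets_diff_points: "diff_points \<in> sets lebesgue"
proof -
  have "diff_points = {a..b} - ({a..b} - diff_points)"
    using diff_points_subset by auto
  then show ?thesis
    using negligible_imp_sets[OF negligible_non_diff_points] by (metis sets.Diff lmeasurable_interval(1) fmeasurableD)
qed

lemma derivative_lower_bound:
  assumes "t \<in> diff_points"
  shows "c \<le> \<bar>\<phi>' t\<bar>"
proof -
  have t: "t \<in> {a..b}" "((\<lambda>y. (\<phi> y - \<phi> t) / (y - t)) \<longlongrightarrow> \<phi>' t) (at t within {a..b})"
    using assms by (auto simp: diff_points_def has_field_derivative_iff)
  have "at t within {a..b} \<noteq> bot"
    using t ab by (simp add: at_within_Icc_at trivial_limit_within islimpt_Icc)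
  then show ?thesis
  proof (rule tendsto_lowerbound[OF tendsto_rabs[OF t(2)], rotated])
    show "\<forall>\<^sub>F y in at t within {a..b}. c \<le> \<bar>(\<phi> y - \<phi> t) / (y - t)\<bar>"
      unfolding eventually_at_filter
      using bilipschitz_lower[OF _ t(1)] by (intro always_eventually) (auto simp: abs_divide le_divide_eq)
  qed
qed

text \<open>
  A Lipschitz map sends null sets to null sets, so the differentiability points of \<open>(s, t]\<close> are
  mapped onto almost all of the segment from \<open>\<phi> s\<close> to \<open>\<phi> t\<close>.
\<close>

lemma change_of_variables_indicator:
  assumes E: "E \<in> sets lebesgue" and st: "a \<le> s" "s \<le> t" "t \<le> b"
  defines "T \<equiv> diff_points \<inter> {s<..t}"
  shows "set_integrable lebesgue T (\<lambda>x. \<bar>\<phi>' x\<bar> * indicator E (\<phi> x))"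
    and "(LINT x:T|lebesgue. \<bar>\<phi>' x\<bar> * indicator E (\<phi> x))
        = measure lebesgue (E \<inter> closed_segment (\<phi> s) (\<phi> t))"
proof -
  let ?seg = "closed_segment (\<phi> s) (\<phi> t)"
  have T: "T \<in> sets lebesgue" "T \<subseteq> {a..b}" "T \<subseteq> {s..t}"
    using sets_diff_points diff_points_subset by (auto simp: T_def)
  have sub: "\<phi> ` T \<subseteq> ?seg"
    using bilipschitz_image_segment[OF st] T by auto
  have "negligible (({a..b} - diff_points) \<union> {s})"
    using negligible_non_diff_points by simp
  moreover have "{s..t} - T \<subseteq> ({a..b} - diff_points) \<union> {s}"
    using st by (auto simp: T_def)
  ultimately have "negligible ({s..t} - T)"
    by (rule negligible_subset)
  then have "negligible (\<phi> ` ({s..t} - T))"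
    using st by (intro negligible_bilipschitz_image) auto
  moreover have "?seg - \<phi> ` T \<subseteq> \<phi> ` ({s..t} - T)"
    using bilipschitz_image_segment[OF st] by auto
  ultimately have neg: "negligible (?seg - \<phi> ` T)"
    by (rule negligible_subset)
  have seg: "?seg \<in> lmeasurable"
    by (simp add: lmeasurable_compact)
  have "\<phi> ` T = ?seg - (?seg - \<phi> ` T)"
    using sub by auto
  then have img: "\<phi> ` T \<in> lmeasurable"
    using seg neg by (metis fmeasurable_Diff negligible_imp_sets)
  then have imgE: "E \<inter> \<phi> ` T \<in> lmeasurable"
    using fmeasurable_Int_fmeasurable[OF img E] by (simp only: Int_commute)
  have ind: "indicator (\<phi> ` T) x *\<^sub>R indicator E x = (indicator (E \<inter> \<phi> ` T) x :: real)" for x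
    by (auto simp: indicator_def)
  have int: "set_integrable lebesgue (\<phi> ` T) (indicator E :: real \<Rightarrow> real)"
    unfolding set_integrable_def using imgE
    unfolding ind by (intro integrable_real_indicator) (auto simp: fmeasurable_def)
  have "integral (\<phi> ` T) (indicator E) = measure lebesgue (E \<inter> \<phi> ` T)"
    using set_lebesgue_integral_eq_integral(2)[OF int]
    by (simp add: set_lebesgue_integral_def ind[unfolded real_scaleR_def])
  also have "\<dots> = measure lebesgue (E \<inter> ?seg)"
  proof (rule measure_negligible_symdiff)
    show "E \<inter> ?seg \<in> lmeasurable"
      using fmeasurable_Int_fmeasurable[OF seg E] by (simp only: Int_commute)
    show "negligible ((E \<inter> ?seg - E \<inter> \<phi> ` T) \<union> (E \<inter> \<phi> ` T - E \<inter> ?seg))"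
      by (rule negligible_subset[OF neg]) (use sub in auto)
  qed
  finally have "(indicator E :: real \<Rightarrow> real) absolutely_integrable_on \<phi> ` T
      \<and> integral (\<phi> ` T) (indicator E) = measure lebesgue (E \<inter> ?seg)"
    using int by simp
  moreover have "(\<phi> has_field_derivative \<phi>' x) (at x within T)" if "x \<in> T" for x
    using that T by (auto simp: T_def diff_points_def intro: has_field_derivative_subset)
  moreover have "inj_on \<phi> T"
    using inj_on_subset[OF bilipschitz_inj_on] T by auto
  ultimately have *: "(\<lambda>x. \<bar>\<phi>' x\<bar> * indicator E (\<phi> x) :: real) absolutely_integrable_on T \<and>
           integral T (\<lambda>x. \<bar>\<phi>' x\<bar> * indicator E (\<phi> x)) = measure lebesgue (E \<inter> ?seg)"
    using has_absolute_integral_change_of_variables_1'[OF T(1), of \<phi> \<phi>' "indicator E"] by blast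
  then show "set_integrable lebesgue T (\<lambda>x. \<bar>\<phi>' x\<bar> * indicator E (\<phi> x))" by simp
  then show "(LINT x:T|lebesgue. \<bar>\<phi>' x\<bar> * indicator E (\<phi> x)) = measure lebesgue (E \<inter> ?seg)"
    using * by (simp add: set_lebesgue_integral_eq_integral)
qed

text \<open>
  The change of variables formula yields measurability of \<open>\<bar>\<phi>'\<bar> 1\<^sub>E \<circ> \<phi>\<close> on the differentiability
  points. As \<open>\<phi>'\<close> does not vanish there, this function is positive exactly on the preimage of \<open>E\<close>.
\<close>

lemma sets_lebesgue_bilipschitz_vimage:
  assumes E: "E \<in> sets lebesgue"
  shows "{x \<in> {a..b}. \<phi> x \<in> E} \<in> sets lebesgue"
proof -
  let ?T = "diff_points \<inter> {a<..b}"
  let ?F = "\<lambda>x. indicator ?T x *\<^sub>R (\<bar>\<phi>' x\<bar> * indicator E (\<phi> x) :: real)"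
  have "integrable lebesgue ?F"
    using change_of_variables_indicator(1)[OF E, of a b] ab by (simp add: set_integrable_def)
  then have "?F \<in> borel_measurable lebesgue"
    by (rule borel_measurable_integrable)
  then have "{x \<in> space lebesgue. 0 < ?F x} \<in> sets lebesgue"
    by measurable
  moreover have "{x \<in> space lebesgue. 0 < ?F x} = {x \<in> ?T. \<phi> x \<in> E}"
    using derivative_lower_bound c by (force simp: indicator_def split: if_splits)
  ultimately have "{x \<in> ?T. \<phi> x \<in> E} \<in> sets lebesgue" by simp
  moreover have "negligible (({a..b} - diff_points) \<union> {a})"
    using negligible_non_diff_points by simp
  then have "negligible {x \<in> {a..b} - ?T. \<phi> x \<in> E}"
    by (rule negligible_subset) auto
  then have "{x \<in> {a..b} - ?T. \<phi> x \<in> E} \<in> sets lebesgue"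
    by (rule negligible_imp_sets)
  moreover have "{x \<in> {a..b}. \<phi> x \<in> E} = {x \<in> ?T. \<phi> x \<in> E} \<union> {x \<in> {a..b} - ?T. \<phi> x \<in> E}"
    using diff_points_subset by auto
  ultimately show ?thesis by simp
qed

text \<open>
  The weight \<open>max \<bar>\<phi>'\<bar> c\<close> agrees with \<open>\<bar>\<phi>'\<bar>\<close> at every differentiability point and is bounded
  away from zero everywhere, also on the null set where \<open>\<phi>'\<close> is arbitrary.
\<close>

lemma measure_segment_eq_weighted:
  assumes E: "E \<in> sets lebesgue" and st: "a \<le> s" "s \<le> t" "t \<le> b"
    and m: "(\<lambda>x. max \<bar>\<phi>' x\<bar> c) \<in> borel_measurable (lebesgue_on {a..b})"
  shows "measure lebesgue (E \<inter> closed_segment (\<phi> s) (\<phi> t))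
      = (LINT x|lebesgue_on {a..b}. max \<bar>\<phi>' x\<bar> c * indicator {s<..t} x * indicator E (\<phi> x))"
proof -
  let ?T = "diff_points \<inter> {s<..t}"
  let ?F = "\<lambda>x. max \<bar>\<phi>' x\<bar> c * indicator {s<..t} x * indicator E (\<phi> x) :: real"
  have Fm: "(\<lambda>x. indicator {a..b} x *\<^sub>R ?F x) \<in> borel_measurable lebesgue"
  proof -
    have "(\<lambda>x. (indicator {a..b} x *\<^sub>R max \<bar>\<phi>' x\<bar> c) * indicator {s<..t} x
        * indicator {x \<in> {a..b}. \<phi> x \<in> E} x :: real) \<in> borel_measurable lebesgue"
      using m sets_lebesgue_bilipschitz_vimage[OF E]
      by (intro borel_measurable_times borel_measurable_indicator)
        (simp_all add: borel_measurable_restrict_space_iff)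
    also have "(\<lambda>x. (indicator {a..b} x *\<^sub>R max \<bar>\<phi>' x\<bar> c) * indicator {s<..t} x
        * indicator {x \<in> {a..b}. \<phi> x \<in> E} x :: real) = (\<lambda>x. indicator {a..b} x *\<^sub>R ?F x)"
      by (auto simp: indicator_def)
    finally show ?thesis .
  qed
  have "AE x in lebesgue. x \<notin> {a..b} - diff_points"
    using negligible_non_diff_points by (intro AE_not_in) (simp add: negligible_iff_null_sets)
  then have ae: "AE x in lebesgue. indicator ?T x *\<^sub>R (\<bar>\<phi>' x\<bar> * indicator E (\<phi> x))
      = indicator {a..b} x *\<^sub>R ?F x"
  proof eventually_elim
    case (elim x)
    show ?case
    proof (cases "x \<in> ?T")
      case True
      then show ?thesis
        using derivative_lower_bound[of x] diff_points_subset st by (auto simp: indicator_def max_def)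
    next
      case False
      with elim show ?thesis by (auto simp: indicator_def)
    qed
  qed
  have "measure lebesgue (E \<inter> closed_segment (\<phi> s) (\<phi> t))
      = (LINT x|lebesgue. indicator ?T x *\<^sub>R (\<bar>\<phi>' x\<bar> * indicator E (\<phi> x)))"
    using change_of_variables_indicator(2)[OF E st] by (simp add: set_lebesgue_integral_def)
  also have "\<dots> = (LINT x|lebesgue. indicator {a..b} x *\<^sub>R ?F x)"
    using change_of_variables_indicator(1)[OF E st] Fm ae
    by (intro integral_cong_AE) (auto simp: set_integrable_def)
  also have "\<dots> = (LINT x|lebesgue_on {a..b}. ?F x)"
    by (subst integral_restrict_space) auto
  finally show ?thesis .
qed

end

section \<open>Young integrals of image measures\<close>

text \<open>
  The estimate makes \<open>f\<close> continuous at every continuity point of \<open>W\<close>, and the monotone function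
  \<open>W\<close> has at most countably many other points.
\<close>

lemma control_countable_discont:
  fixes f W :: "real \<Rightarrow> real"
  assumes W: "mono_on A W" and "0 < \<gamma>"
    and f: "\<And>s t. s \<in> A \<Longrightarrow> t \<in> A \<Longrightarrow> s \<le> t \<Longrightarrow> \<bar>f t - f s\<bar> \<le> K * (W t - W s) powr \<gamma>"
  shows "countable {x \<in> A. \<not> continuous (at x within A) f}"
proof (rule countable_subset[OF _ mono_on_ctble_discont[OF W]], safe)
  fix x assume x: "x \<in> A" "\<not> continuous (at x within A) f" "continuous (at x within A) W"
  have bound: "\<bar>f y - f x\<bar> \<le> K * \<bar>W y - W x\<bar> powr \<gamma>" if "y \<in> A" for y
  proof (cases "x \<le> y")
    case True
    then show ?thesis using f[of x y] mono_onD[OF W, of x y] x that by simp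
  next
    case False
    then show ?thesis using f[of y x] mono_onD[OF W, of y x] x that by (simp add: abs_minus_commute)
  qed
  have "((\<lambda>y. W y - W x) \<longlongrightarrow> W x - W x) (at x within A)"
    using x(3) by (intro tendsto_intros) (simp add: continuous_within)
  then have "((\<lambda>y. \<bar>W y - W x\<bar>) \<longlongrightarrow> 0) (at x within A)"
    by (simp add: tendsto_rabs_zero_iff)
  then have lim: "((\<lambda>y. K * \<bar>W y - W x\<bar> powr \<gamma>) \<longlongrightarrow> 0) (at x within A)"
    using \<open>0 < \<gamma>\<close> by (intro tendsto_mult_right_zero tendsto_zero_powrI[OF _ tendsto_const]) auto
  have "\<forall>\<^sub>F y in at x within A. norm (f y - f x) \<le> K * \<bar>W y - W x\<bar> powr \<gamma>"
    unfolding eventually_at_filter using bound by (intro always_eventually) simp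
  then have "((\<lambda>y. f y - f x) \<longlongrightarrow> 0) (at x within A)"
    using lim by (rule Lim_null_comparison)
  then have "continuous (at x within A) f"
    by (simp add: continuous_within LIM_zero_iff)
  with x(2) show False by simp
qed

lemma borel_measurable_lebesgue_on:
  "f \<in> borel_measurable borel \<Longrightarrow> f \<in> borel_measurable (lebesgue_on S)"
  by (intro measurable_restrict_space1 measurable_completion) simp

lemma control_borel_measurable:
  fixes f W :: "real \<Rightarrow> real"
  assumes "a \<le> b" and W: "mono_on {a..b} W" and "0 < \<gamma>"
    and f: "\<And>s t. a \<le> s \<Longrightarrow> s \<le> t \<Longrightarrow> t \<le> b \<Longrightarrow> \<bar>f t - f s\<bar> \<le> K * (W t - W s) powr \<gamma>"
  shows "f \<in> borel_measurable (lebesgue_on {a..b})"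
proof -
  \<comment> \<open>Clamping to \<open>[a, b]\<close> extends both functions, and the estimate between them, to the whole line.\<close>
  let ?cl = "\<lambda>x. max a (min b x)"
  have cl: "?cl x \<in> {a..b}" for x using \<open>a \<le> b\<close> by auto
  have mono: "mono_on UNIV (\<lambda>x. W (?cl x))"
  proof (rule mono_onI)
    fix x y :: real assume "x \<le> y"
    then have "?cl x \<le> ?cl y" by linarith
    then show "W (?cl x) \<le> W (?cl y)" using mono_onD[OF W cl cl] by blast
  qed
  have "\<bar>f (?cl t) - f (?cl s)\<bar> \<le> K * (W (?cl t) - W (?cl s)) powr \<gamma>" if "s \<le> t" for s t
  proof (rule f)
    show "?cl s \<le> ?cl t" using that by linarith
  qed (use \<open>a \<le> b\<close> in auto)
  then have "countable {x \<in> UNIV. \<not> continuous (at x within UNIV) (\<lambda>x. f (?cl x))}"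
    by (intro control_countable_discont[OF mono \<open>0 < \<gamma>\<close>]) auto
  then have "(\<lambda>x. f (?cl x)) \<in> borel_measurable borel"
    by (rule borel_measurable_continuous_countable_exceptions)
      (auto intro: continuous_at_imp_continuous_on)
  then have "(\<lambda>x. f (?cl x)) \<in> borel_measurable (lebesgue_on {a..b})"
    by (rule borel_measurable_lebesgue_on)
  then show ?thesis
    by (rule measurable_cong[THEN iffD1, rotated]) (auto simp: max_def min_def)
qed

lemma step_function_value:
  fixes u :: "nat \<Rightarrow> real"
  assumes "\<And>i. i \<le> n \<Longrightarrow> u i \<le> u (Suc i)" "x \<in> {u 0<..u (Suc n)}"
  obtains j where "j \<le> n" "x \<in> {u j<..u (Suc j)}"
    "\<And>h. (\<Sum>i\<le>n. h i * indicator {u i<..u (Suc i)} x) = (h j :: real)"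
  using assms
proof (induction n arbitrary: thesis)
  case 0
  show ?case by (rule "0.prems"(1)[of 0]) (use "0.prems" in auto)
next
  case (Suc n)
  show ?case
  proof (cases "x \<le> u (Suc n)")
    case True
    obtain j where "j \<le> n" "x \<in> {u j<..u (Suc j)}"
      "\<And>h. (\<Sum>i\<le>n. h i * indicator {u i<..u (Suc i)} x) = (h j :: real)"
      by (rule Suc.IH) (use Suc.prems(2,3) True in auto)
    then show ?thesis
      using True by (intro Suc.prems(1)[of j]) auto
  next
    case False
    have "indicator {u i<..u (Suc i)} x = (0::real)" if "i \<le> n" for i
    proof -
      have "u (Suc i) \<le> u (Suc n)"
        by (rule step_mono_le[of "Suc n" u]) (use Suc.prems(2) that in simp_all)
      then show ?thesis using False by (simp add: indicator_def)
    qed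
    then have "(\<Sum>i\<le>n. h i * indicator {u i<..u (Suc i)} x) = (0::real)" for h
      by simp
    then show ?thesis
      using False Suc.prems(3) by (intro Suc.prems(1)[of "Suc n"]) auto
  qed
qed

text \<open>
  The weight \<open>G m 1\<^sub>(\<^sub>s\<^sub>,\<^sub>t\<^sub>]\<close> is the limit of the weights of the Riemann sums over equidistant
  partitions, at every continuity point of \<open>G\<close>. The sums obey the bound of Young's inequality, which
  passes to the limit by lower semicontinuity of the norm.
\<close>

theorem young_weighted_image:
  fixes X :: "real \<Rightarrow> 'a::euclidean_space" and G W m :: "real \<Rightarrow> real"
  assumes p: "1 \<le> p" and q: "1 \<le> q" and "a \<le> b"
    and X: "X \<in> borel_measurable (lebesgue_on {a..b})"
    and m: "integrable (lebesgue_on {a..b}) m"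
    and incr: "\<And>s t. a \<le> s \<Longrightarrow> s \<le> t \<Longrightarrow> t \<le> b \<Longrightarrow>
        SBE_norm \<alpha> p q (weighted_image (lebesgue_on {a..b}) X (\<lambda>x. m x * indicator {s<..t} x))
          \<le> ennreal ((W t - W s) powr \<beta>)"
    and W: "mono_on {a..b} W"
    and G: "\<And>s t. a \<le> s \<Longrightarrow> s \<le> t \<Longrightarrow> t \<le> b \<Longrightarrow> \<bar>G t - G s\<bar> \<le> K * (W t - W s) powr \<gamma>"
    and nonneg: "0 \<le> K" "0 \<le> \<beta>" "0 < \<gamma>" and young: "1 < \<beta> + \<gamma>"
    and st: "a \<le> s" "s \<le> t" "t \<le> b"
  shows "SBE_norm \<alpha> p q (weighted_image (lebesgue_on {a..b}) X (\<lambda>x. G x * (m x * indicator {s<..t} x)))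
    \<le> ennreal (\<bar>G s\<bar> * (W t - W s) powr \<beta>
        + K * (2 * (W t - W s)) powr (\<beta> + \<gamma>) * (\<Sum>k. real k powr - (\<beta> + \<gamma>)))"
    (is "_ \<le> ennreal ?C")
proof -
  let ?M = "lebesgue_on {a..b}"
  let ?\<nu> = "weighted_image ?M X"
  have sf: "sigma_finite_measure ?M"
    by (rule finite_measure.axioms(1)[OF finite_measure_lebesgue_on]) simp
  have ind [measurable]: "indicator {x<..y} \<in> borel_measurable ?M" for x y :: real
    by (intro borel_measurable_lebesgue_on) simp
  have Gm [measurable]: "G \<in> borel_measurable ?M"
    using control_borel_measurable[OF \<open>a \<le> b\<close> W \<open>0 < \<gamma>\<close> G] .
  note [measurable] = X borel_measurable_integrable[OF m]
  have meas: "ball_measurable (?\<nu> h)" if "h \<in> borel_measurable ?M" for h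
    by (rule ball_measurable_weighted_image[OF sf X that])
  have int_incr: "integrable ?M (\<lambda>x. m x * indicator {x'<..y} x)" for x' y
  proof (rule Bochner_Integration.integrable_bound[OF m])
    show "(\<lambda>x. m x * indicator {x'<..y} x) \<in> borel_measurable ?M" by measurable
  qed (auto simp: indicator_def)
  define B where "B h c \<longleftrightarrow> integrable ?M h \<and> 0 \<le> c \<and> SBE_norm \<alpha> p q (?\<nu> h) \<le> ennreal c" for h c
  have B_add: "B (\<lambda>x. h x + k x) (c + d)" if "B h c" "B k d" for h k c d
  proof -
    have hk: "integrable ?M h" "integrable ?M k" "0 \<le> c" "0 \<le> d"
      "SBE_norm \<alpha> p q (?\<nu> h) \<le> ennreal c" "SBE_norm \<alpha> p q (?\<nu> k) \<le> ennreal d"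
      using that by (auto simp: B_def)
    have "SBE_norm \<alpha> p q (?\<nu> (\<lambda>x. h x + k x)) = SBE_norm \<alpha> p q (\<lambda>A. ?\<nu> h A + ?\<nu> k A)"
      by (intro SBE_norm_cong weighted_image_add hk X)
    also have "\<dots> \<le> SBE_norm \<alpha> p q (?\<nu> h) + SBE_norm \<alpha> p q (?\<nu> k)"
      using hk by (intro SBE_norm_add_le p q meas) auto
    also have "\<dots> \<le> ennreal (c + d)"
      using hk by (simp add: add_mono)
    finally show ?thesis using hk by (simp add: B_def)
  qed
  have B_cmult: "B (\<lambda>x. e * h x) (\<bar>e\<bar> * c)" if "B h c" for h e c
  proof -
    have h: "integrable ?M h" "0 \<le> c" "SBE_norm \<alpha> p q (?\<nu> h) \<le> ennreal c"
      using that by (auto simp: B_def)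
    have "SBE_norm \<alpha> p q (?\<nu> (\<lambda>x. e * h x)) = SBE_norm \<alpha> p q (\<lambda>A. e * ?\<nu> h A)"
      by (intro SBE_norm_cong weighted_image_cmult)
    also have "\<dots> \<le> ennreal \<bar>e\<bar> * SBE_norm \<alpha> p q (?\<nu> h)"
      using h by (intro SBE_norm_cmult_le p q meas) auto
    also have "\<dots> \<le> ennreal (\<bar>e\<bar> * c)"
      using h by (simp add: ennreal_mult mult_left_mono)
    finally show ?thesis using h by (simp add: B_def)
  qed
  have B_mono: "B h d" if "B h c" "c \<le> d" for h c d
    using that unfolding B_def by (meson ennreal_leI order_trans)
  have B_incr: "B (\<lambda>x. m x * indicator {s<..t} x) ((W t - W s) powr \<beta>)"
    if "a \<le> s" "s \<le> t" "t \<le> b" for s t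
    using incr[OF that] int_incr by (simp add: B_def)
  define u where "u n i = s + (t - s) * (real i / real (Suc n))" for n i
  define h where "h n x = (\<Sum>i\<le>n. G (u n i) * (m x * indicator {u n i<..u n (Suc i)} x))" for n x
  have u0: "u n 0 = s" and u1: "u n (Suc n) = t" for n
    by (auto simp: u_def simp del: of_nat_Suc)
  have u_step: "u n (Suc i) - u n i = (t - s) / real (Suc n)" for n i
    by (simp add: u_def algebra_simps diff_divide_distrib[symmetric])
  have u_mono: "u n i \<le> u n j" if "i \<le> j" for i j n
    using that st by (auto simp: u_def intro!: mult_left_mono divide_right_mono)
  have hB: "B (h n) ?C" for n
  proof -
    have steps: "\<And>i. i \<le> n \<Longrightarrow> u n i \<le> u n (Suc i)" and ends: "a \<le> u n 0" "u n (Suc n) \<le> b"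
      using u_mono st by (simp_all add: u0 u1)
    have "0 \<le> \<gamma>" using nonneg by simp
    have "B (h n) (\<bar>G (u n 0)\<bar> * (W (u n (Suc n)) - W (u n 0)) powr \<beta>
        + K * (2 * (W (u n (Suc n)) - W (u n 0))) powr (\<beta> + \<gamma>) * (\<Sum>k. real k powr - (\<beta> + \<gamma>)))"
      unfolding h_def
      by (rule young_riemann_sum_bound[where B = B and G = G and W = W and m = m and a = a and b = b
            and \<beta> = \<beta> and \<gamma> = \<gamma> and K = K and u = "u n" and n = n])
        (fact B_add B_cmult B_mono B_incr W G nonneg \<open>0 \<le> \<gamma>\<close> steps ends young)+
    then show ?thesis by (simp only: u0 u1)
  qed
  define g where "g x = G x * (m x * indicator {s<..t} x)" for x
  define R where "R = \<bar>G a\<bar> + K * (W b - W a) powr \<gamma>"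
  have GR: "\<bar>G x\<bar> \<le> R" if "x \<in> {a..b}" for x
  proof -
    have "\<bar>G x - G a\<bar> \<le> K * (W x - W a) powr \<gamma>"
      using that by (intro G) auto
    also have "\<dots> \<le> K * (W b - W a) powr \<gamma>"
      using that mono_onD[OF W, of a x] mono_onD[OF W, of x b] nonneg
      by (intro mult_left_mono powr_mono2) auto
    finally show ?thesis unfolding R_def by linarith
  qed
  \<comment> \<open>Inside \<open>(s, t]\<close> a Riemann sum takes a value of \<open>G\<close> at a nearby partition point.\<close>
  have value_in: "\<exists>y\<in>{a..b}. \<bar>y - x\<bar> \<le> (t - s) / real (Suc n) \<and> h n x = G y * m x"
    if "x \<in> {s<..t}" for x n
  proof -
    have "x \<in> {u n 0<..u n (Suc n)}" using that by (simp add: u0 u1)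
    then obtain j where j: "j \<le> n" "x \<in> {u n j<..u n (Suc j)}"
      "\<And>f. (\<Sum>i\<le>n. f i * indicator {u n i<..u n (Suc i)} x) = (f j :: real)"
      by (rule step_function_value[of n "u n" x, rotated]) (use u_mono in auto)
    have "h n x = G (u n j) * m x"
      using j(3)[of "\<lambda>i. G (u n i) * m x"] by (simp add: h_def mult.assoc)
    moreover have "\<bar>u n j - x\<bar> \<le> (t - s) / real (Suc n)"
      using j(2) u_step[of n j] by auto
    moreover have "u n j \<in> {a..b}"
      using u_mono[of 0 j n] u_mono[of j "Suc n" n] j(1) st by (auto simp: u0 u1)
    ultimately show ?thesis by blast
  qed
  have value_out: "h n x = 0" if "x \<notin> {s<..t}" for x n
  proof -
    have "indicator {u n i<..u n (Suc i)} x = (0::real)" if "i \<le> n" for i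
      using u_mono[of 0 i n] u_mono[of "Suc i" "Suc n" n] that \<open>x \<notin> {s<..t}\<close>
      by (auto simp: indicator_def u0 u1)
    then show ?thesis by (simp add: h_def)
  qed
  have dominated: "\<bar>h n x\<bar> \<le> R * \<bar>m x\<bar>" for n x
  proof (cases "x \<in> {s<..t}")
    case True
    then show ?thesis using value_in[OF True, of n] GR by (auto simp: abs_mult intro!: mult_right_mono)
  next
    case False
    have "0 \<le> R" using GR[of a] \<open>a \<le> b\<close> by (auto intro: order_trans[OF abs_ge_zero])
    then show ?thesis using value_out[OF False] by simp
  qed
  have tendsto: "(\<lambda>n. h n x) \<longlonglongrightarrow> g x" if x: "x \<in> {a..b}" "continuous (at x within {a..b}) G" for x
  proof (cases "x \<in> {s<..t}")
    case True
    obtain y where y: "\<And>n. y n \<in> {a..b}" "\<And>n. \<bar>y n - x\<bar> \<le> (t - s) / real (Suc n)"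
      "\<And>n. h n x = G (y n) * m x"
      using value_in[OF True] by metis
    have "(\<lambda>n. (t - s) / real (Suc n)) \<longlonglongrightarrow> 0"
      using LIMSEQ_inverse_real_of_nat[THEN tendsto_mult_right_zero, of "t - s"]
      by (simp add: divide_inverse)
    then have "(\<lambda>n. y n - x) \<longlonglongrightarrow> 0"
      by (rule Lim_null_comparison[rotated]) (use y(2) in auto)
    then have "y \<longlonglongrightarrow> x"
      by (simp add: LIM_zero_iff)
    then have "(\<lambda>n. G (y n)) \<longlonglongrightarrow> G x"
      using x y(1) by (intro continuous_within_tendsto_compose'[of x "{a..b}" G y sequentially]) auto
    then show ?thesis
      using True by (auto simp: y(3) g_def intro!: tendsto_intros)
  next
    case False
    then show ?thesis by (simp add: value_out g_def)
  qed
  let ?D = "{x \<in> {a..b}. \<not> continuous (at x within {a..b}) G}"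
  have "countable ?D"
    using G by (intro control_countable_discont[OF W \<open>0 < \<gamma>\<close>]) auto
  then have "AE x in lebesgue. x \<notin> ?D"
    by (intro AE_not_in null_sets_completionI countable_imp_null_set_lborel)
  then have ae: "AE x in ?M. (\<lambda>n. h n x) \<longlonglongrightarrow> g x"
    using tendsto by (subst AE_restrict_space_iff) (auto elim!: eventually_mono)
  have h_meas: "h n \<in> borel_measurable ?M" for n
    using hB[of n] unfolding B_def by (auto dest: borel_measurable_integrable)
  have g_meas: "g \<in> borel_measurable ?M"
    unfolding g_def by measurable
  have "(\<lambda>n. ?\<nu> (h n) A) \<longlonglongrightarrow> ?\<nu> g A" if "A \<in> sets borel" for A
    using m dominated
    by (intro weighted_image_tendsto[OF X h_meas g_meas that ae, where w = "\<lambda>x. R * \<bar>m x\<bar>"]) auto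
  then show ?thesis
    unfolding g_def[symmetric]
    by (rule SBE_norm_le_limit[OF p q meas[OF g_meas] meas[OF h_meas]])
      (use hB in \<open>auto simp only: B_def\<close>)
qed

section \<open>Increments of occupation measures\<close>

lemma lebesgue_on_measurable_iff:
  assumes "S \<in> sets lebesgue"
  shows "X \<in> borel_measurable (lebesgue_on S) \<longleftrightarrow> (\<forall>B\<in>sets borel. {x \<in> S. X x \<in> B} \<in> sets lebesgue)"
proof -
  have "X -` B \<inter> space (lebesgue_on S) = {x \<in> S. X x \<in> B}" for B by auto
  then show ?thesis
    using assms by (auto simp: measurable_def sets_restrict_space_iff)
qed

lemma SBE_norm_null:
  fixes \<nu> :: "'a::euclidean_space set \<Rightarrow> real"
  assumes "1 \<le> p" "1 \<le> q" "\<And>B. B \<in> sets borel \<Longrightarrow> \<nu> B = 0"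
  shows "SBE_norm \<alpha> p q \<nu> = 0"
proof -
  have "SBE_norm \<alpha> p q \<nu> = SBE_norm \<alpha> p q (\<lambda>B::'a set. 0 * 0)"
    using assms by (intro SBE_norm_cong) simp
  also have "\<dots> \<le> ennreal \<bar>0\<bar> * SBE_norm \<alpha> p q (\<lambda>B::'a set. 0)"
    using assms by (intro SBE_norm_cmult_le) (auto simp: ball_measurable_def ball_mass_def)
  finally show ?thesis by simp
qed

lemma occupation_measure_diff:
  assumes X: "X \<in> borel_measurable (lebesgue_on {a..b})" and B: "B \<in> sets borel"
    and st: "a \<le> s" "s \<le> t" "t \<le> b"
  shows "occupation_measure X a t B - occupation_measure X a s B
      = measure lebesgue ({x \<in> {a..b}. X x \<in> B} \<inter> {s..t})"
proof -
  let ?E = "{x \<in> {a..b}. X x \<in> B}"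
  have E: "?E \<in> sets lebesgue"
    using X B by (simp add: lebesgue_on_measurable_iff)
  have fin: "?E \<inter> {x..y} \<in> lmeasurable" for x y :: real
    using fmeasurable_Int_fmeasurable[OF lmeasurable_interval(1) E, of x y] by (simp only: Int_commute)
  have occ: "occupation_measure X a x B = measure lebesgue (?E \<inter> {a..x})" if "x \<le> b" for x
    unfolding occupation_measure_def using that by (intro arg_cong[where f = "measure lebesgue"]) auto
  have union: "?E \<inter> {a..t} = (?E \<inter> {a..s}) \<union> (?E \<inter> {s..t})"
    using st by auto
  have neg: "negligible ((?E \<inter> {a..s}) \<inter> (?E \<inter> {s..t}))"
    by (rule negligible_subset[of "{s}"]) auto
  have "measure lebesgue (?E \<inter> {a..t}) = measure lebesgue (?E \<inter> {a..s}) + measure lebesgue (?E \<inter> {s..t})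
      + measure lebesgue ({} :: real set)"
  proof (rule measure_Un3_negligible[OF fin fin _ neg])
    show "{} \<in> lmeasurable" by (simp add: fmeasurable_def)
  qed (simp_all only: union Un_empty_right Int_empty_right negligible_empty)
  then show ?thesis
    using st by (simp add: occ)
qed

lemma occupation_measure_diff_eq_weighted_image:
  assumes X: "X \<in> borel_measurable (lebesgue_on {a..b})" and B: "B \<in> sets borel"
    and st: "a \<le> s" "s \<le> t" "t \<le> b"
  shows "occupation_measure X a t B - occupation_measure X a s B
      = weighted_image (lebesgue_on {a..b}) X (indicator {s<..t}) B"
proof -
  let ?E = "{x \<in> {a..b}. X x \<in> B}"
  have E: "?E \<in> sets lebesgue"
    using X B by (simp add: lebesgue_on_measurable_iff)
  have "weighted_image (lebesgue_on {a..b}) X (indicator {s<..t}) B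
      = (LINT x|lebesgue. indicator {a..b} x *\<^sub>R (indicator {s<..t} x * indicator B (X x)))"
    unfolding weighted_image_def by (subst integral_restrict_space) auto
  also have "\<dots> = (LINT x|lebesgue. indicator (?E \<inter> {s<..t}) x)"
    by (intro Bochner_Integration.integral_cong) (auto simp: indicator_def)
  also have "\<dots> = measure lebesgue (?E \<inter> {s<..t})"
    by simp
  also have "\<dots> = measure lebesgue (?E \<inter> {s..t})"
  proof (rule measure_negligible_symdiff)
    show "?E \<inter> {s..t} \<in> lmeasurable"
      using fmeasurable_Int_fmeasurable[OF lmeasurable_interval(1) E, of s t] by (simp only: Int_commute)
    show "negligible ((?E \<inter> {s..t} - ?E \<inter> {s<..t}) \<union> (?E \<inter> {s<..t} - ?E \<inter> {s..t}))"
      by (rule negligible_subset[of "{s}"]) auto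
  qed
  also have "\<dots> = occupation_measure X a t B - occupation_measure X a s B"
    by (rule occupation_measure_diff[OF assms, symmetric])
  finally show ?thesis by simp
qed

lemma occupation_measure_start: "occupation_measure X a a B = 0"
proof -
  have "negligible {\<tau> \<in> {a..a}. X \<tau> \<in> B}"
    by (rule negligible_subset[of "{a}"]) auto
  then show ?thesis
    unfolding occupation_measure_def by (simp add: negligible_imp_measure0)
qed

lemma finite_signed_measure_occupation:
  assumes X: "X \<in> borel_measurable (lebesgue_on {a..b})" and t: "t \<le> b"
  shows "finite_signed_measure (occupation_measure X a t)"
  unfolding finite_signed_measure_def
proof (intro allI impI)
  fix A :: "nat \<Rightarrow> 'a set" assume A: "range A \<subseteq> sets borel" "disjoint_family A"
  define S where "S i = {x \<in> {a..t}. X x \<in> A i}" for i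
  have "{x \<in> {a..b}. X x \<in> A i} \<inter> {a..t} \<in> sets lebesgue" for i
    using X A by (intro sets.Int) (auto simp: lebesgue_on_measurable_iff)
  moreover have "{x \<in> {a..b}. X x \<in> A i} \<inter> {a..t} = S i" for i
    using t by (auto simp: S_def)
  ultimately have S: "range S \<subseteq> sets lebesgue" by auto
  have U: "(\<Union>i. S i) = {x \<in> {a..t}. X x \<in> (\<Union>i. A i)}"
    by (auto simp: S_def)
  have "emeasure lebesgue (\<Union>i. S i) \<le> emeasure lebesgue {a..t}"
    by (intro emeasure_mono) (auto simp: S_def)
  also have "\<dots> < \<infinity>"
    using lmeasurable_interval(1)[of a t] by (simp add: fmeasurable_def)
  finally have "emeasure lebesgue (\<Union>i. S i) \<noteq> \<infinity>" by simp
  moreover have "disjoint_family S"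
    using A(2) by (auto simp: disjoint_family_on_def S_def)
  ultimately have "(\<lambda>i. measure lebesgue (S i)) sums measure lebesgue (\<Union>i. S i)"
    using S by (intro measure_UNION)
  then show "(\<lambda>i. occupation_measure X a t (A i)) sums occupation_measure X a t (\<Union>i. A i)"
    unfolding occupation_measure_def U by (simp add: S_def)
qed

section \<open>Reparametrisation of the path\<close>

theorem proposition3p2:
  fixes \<alpha> r r' \<epsilon> a b a' b' :: real and p q :: ennreal
    and \<omega> :: "real \<Rightarrow> real ^ 'd" and \<phi> \<phi>' :: "real \<Rightarrow> real"
  assumes "\<alpha> > 0" and "1 \<le> p" and "1 \<le> q" and "r > 1"
    and "a < b" and "a' < b'"
    and "\<omega> \<in> borel_measurable (lebesgue_on {a..b})"
    and "(\<lambda>t. occupation_measure \<omega> a t)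
           \<in> finite_variation_space r a b (SBE \<alpha> p q) (SBE_norm \<alpha> p q)"
    and "\<phi> ` {a'..b'} \<subseteq> {a..b}" and "bilipschitz_on {a'..b'} \<phi>"
    and "AE t in lebesgue_on {a'..b'}.
           (\<phi> has_real_derivative \<phi>' t) (at t within {a'..b'})"
    and "1 / r + 1 / r' = 1" and "0 < \<epsilon>" and "\<epsilon> < r'"
    and "\<phi>' \<in> finite_variation_space (r' - \<epsilon>) a' b' UNIV (\<lambda>x. ennreal (norm x))"
  shows "(\<lambda>t. occupation_measure (\<omega> \<circ> \<phi>) a' t)
           \<in> finite_variation_space r a' b' (SBE \<alpha> p q) (SBE_norm \<alpha> p q)"
proof -
  note p = \<open>1 \<le> p\<close> and q = \<open>1 \<le> q\<close> and ab' = \<open>a' < b'\<close> and \<omega> = assms(7)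
  define X where "X = \<omega> \<circ> \<phi>"
  let ?M = "lebesgue_on {a'..b'}"
  let ?occ = "occupation_measure \<omega> a"
  define \<beta> where "\<beta> = 1 / r"
  define \<gamma> where "\<gamma> = 1 / (r' - \<epsilon>)"
  have \<beta>: "0 < \<beta>" and \<gamma>: "0 < \<gamma>"
    using assms by (simp_all add: \<beta>_def \<gamma>_def)
  have young: "1 < \<beta> + \<gamma>"
  proof -
    have "1 / r' < \<gamma>"
      using assms(12-14) by (simp add: \<gamma>_def frac_less2)
    then show ?thesis using assms(12) by (simp add: \<beta>_def)
  qed
  obtain c C where c: "0 < c" and bilip: "\<forall>x\<in>{a'..b'}. \<forall>y\<in>{a'..b'}.
      c * dist x y \<le> dist (\<phi> x) (\<phi> y) \<and> dist (\<phi> x) (\<phi> y) \<le> C * dist x y"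
    using assms(10) unfolding bilipschitz_on_def by blast
  note bilip_facts = ab' c bilip assms(11)
  have \<phi>_in: "\<phi> t \<in> {a..b}" if "t \<in> {a'..b'}" for t
    using assms(9) that by blast

  obtain W1 where W1: "mono_on {a..b} W1"
    and W1_le: "\<And>s t. a \<le> s \<Longrightarrow> s < t \<Longrightarrow> t \<le> b \<Longrightarrow>
        SBE_norm \<alpha> p q (?occ t - ?occ s) \<le> ennreal ((W1 t - W1 s) powr \<beta>)"
    using finite_variation_space_control[OF assms(8)] \<open>r > 1\<close> unfolding \<beta>_def by auto
  obtain W2 where W2: "mono_on {a'..b'} W2"
    and W2_le: "\<And>s t. a' \<le> s \<Longrightarrow> s < t \<Longrightarrow> t \<le> b' \<Longrightarrow>
        ennreal (norm (\<phi>' t - \<phi>' s)) \<le> ennreal ((W2 t - W2 s) powr \<gamma>)"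
    using finite_variation_space_control[OF assms(15)] assms(14) unfolding \<gamma>_def by auto
  obtain W3 where W3: "mono_on {a'..b'} W3"
    and W3_eq: "\<And>s t. a' \<le> s \<Longrightarrow> s \<le> t \<Longrightarrow> t \<le> b' \<Longrightarrow> \<bar>W1 (\<phi> t) - W1 (\<phi> s)\<bar> = W3 t - W3 s"
    using bilipschitz_monotone[OF bilip_facts]
  proof
    assume \<phi>: "mono_on {a'..b'} \<phi>"
    have le: "W1 (\<phi> s) \<le> W1 (\<phi> t)" if "a' \<le> s" "s \<le> t" "t \<le> b'" for s t
      using mono_onD[OF W1 \<phi>_in \<phi>_in] mono_onD[OF \<phi>, of s t] that by simp
    then have "mono_on {a'..b'} (\<lambda>t. W1 (\<phi> t))"
      by (auto intro: mono_onI)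
    then show thesis using that[of "\<lambda>t. W1 (\<phi> t)"] le by auto
  next
    assume \<phi>: "mono_on {a'..b'} (\<lambda>t. - \<phi> t)"
    have le: "W1 (\<phi> t) \<le> W1 (\<phi> s)" if "a' \<le> s" "s \<le> t" "t \<le> b'" for s t
      using mono_onD[OF W1 \<phi>_in \<phi>_in] mono_onD[OF \<phi>, of s t] that by simp
    then have "mono_on {a'..b'} (\<lambda>t. - W1 (\<phi> t))"
      by (auto intro: mono_onI)
    then show thesis using that[of "\<lambda>t. - W1 (\<phi> t)"] le by auto
  qed
  \<comment> \<open>One control for both the derivative of \<open>\<phi>\<close> and the occupation measure along \<open>\<phi>\<close>.\<close>
  define W where "W t = W2 t + W3 t" for t
  have W: "mono_on {a'..b'} W"
    using W2 W3 by (auto simp: W_def mono_on_def intro: add_mono)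
  have W2_W: "W2 t - W2 s \<le> W t - W s" and W3_W: "W3 t - W3 s \<le> W t - W s"
    and W2_nonneg: "0 \<le> W2 t - W2 s" and W3_nonneg: "0 \<le> W3 t - W3 s"
    if "a' \<le> s" "s \<le> t" "t \<le> b'" for s t
    using mono_onD[OF W2, of s t] mono_onD[OF W3, of s t] that by (auto simp: W_def)
  have \<phi>'_le: "\<bar>\<phi>' t - \<phi>' s\<bar> \<le> 1 * (W t - W s) powr \<gamma>" if st: "a' \<le> s" "s \<le> t" "t \<le> b'" for s t
  proof (cases "s = t")
    case False
    then have "\<bar>\<phi>' t - \<phi>' s\<bar> \<le> (W2 t - W2 s) powr \<gamma>"
      using W2_le[of s t] st by simp
    also have "\<dots> \<le> (W t - W s) powr \<gamma>"
      using W2_W[OF st] W2_nonneg[OF st] \<gamma> by (intro powr_mono2) auto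
    finally show ?thesis by simp
  qed simp

  \<comment> \<open>The truncation at \<open>c\<close> only affects a null set, and keeps \<open>1 / m\<close> bounded where \<open>\<phi>'\<close> is arbitrary.\<close>
  define m where "m t = max \<bar>\<phi>' t\<bar> c" for t
  define G where "G t = 1 / m t" for t
  have m_ge: "c \<le> m t" for t by (simp add: m_def)
  have m_pos: "0 < m t" for t using m_ge[of t] c by linarith
  have [measurable]: "\<phi>' \<in> borel_measurable ?M"
    using control_borel_measurable[OF _ W \<gamma> \<phi>'_le] ab' by simp
  have m_meas [measurable]: "m \<in> borel_measurable ?M"
    unfolding m_def by measurable
  have m_int: "integrable ?M m"
  proof -
    define R where "R = \<bar>\<phi>' a'\<bar> + (W b' - W a') powr \<gamma> + c"
    have "norm (m t) \<le> R" if "t \<in> {a'..b'}" for t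
    proof -
      have "\<bar>\<phi>' t - \<phi>' a'\<bar> \<le> (W t - W a') powr \<gamma>"
        using \<phi>'_le[of a' t] that by simp
      also have "\<dots> \<le> (W b' - W a') powr \<gamma>"
        using that \<gamma> mono_onD[OF W, of a' t] mono_onD[OF W, of t b'] by (intro powr_mono2) auto
      finally show ?thesis
        using c unfolding R_def m_def by (auto simp: max_def)
    qed
    then show ?thesis
      by (intro finite_measure.integrable_const_bound[where B = R]
          finite_measure_lebesgue_on m_meas AE_I2) auto
  qed
  have m_indicator_int: "integrable ?M (\<lambda>x. m x * indicator {s<..t} x)" for s t
  proof (rule Bochner_Integration.integrable_bound[OF m_int])
    show "(\<lambda>x. m x * indicator {s<..t} x) \<in> borel_measurable ?M"
      by (intro borel_measurable_times m_meas borel_measurable_lebesgue_on) simp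
  qed (auto simp: indicator_def)
  have X: "X \<in> borel_measurable ?M"
    unfolding lebesgue_on_measurable_iff[OF fmeasurableD[OF lmeasurable_interval(1)]]
  proof
    fix B :: "(real ^ 'd) set" assume "B \<in> sets borel"
    then have "{x \<in> {a..b}. \<omega> x \<in> B} \<in> sets lebesgue"
      using \<omega> by (simp add: lebesgue_on_measurable_iff)
    then have "{x \<in> {a'..b'}. \<phi> x \<in> {x \<in> {a..b}. \<omega> x \<in> B}} \<in> sets lebesgue"
      by (rule sets_lebesgue_bilipschitz_vimage[OF bilip_facts])
    also have "{x \<in> {a'..b'}. \<phi> x \<in> {x \<in> {a..b}. \<omega> x \<in> B}} = {x \<in> {a'..b'}. X x \<in> B}"
      using \<phi>_in by (auto simp: X_def)
    finally show "{x \<in> {a'..b'}. X x \<in> B} \<in> sets lebesgue" .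
  qed

  have weighted: "weighted_image ?M X (\<lambda>x. m x * indicator {s<..t} x) B
      = measure lebesgue ({x \<in> {a..b}. \<omega> x \<in> B} \<inter> closed_segment (\<phi> s) (\<phi> t))"
    if B: "B \<in> sets borel" and st: "a' \<le> s" "s \<le> t" "t \<le> b'" for B s t
  proof -
    let ?E = "{x \<in> {a..b}. \<omega> x \<in> B}"
    have E: "?E \<in> sets lebesgue"
      using \<omega> B by (simp add: lebesgue_on_measurable_iff)
    have "measure lebesgue (?E \<inter> closed_segment (\<phi> s) (\<phi> t))
        = (LINT x|?M. m x * indicator {s<..t} x * indicator ?E (\<phi> x))"
      using measure_segment_eq_weighted[OF bilip_facts E st] m_meas by (simp add: m_def[abs_def])
    also have "\<dots> = weighted_image ?M X (\<lambda>x. m x * indicator {s<..t} x) B"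
      unfolding weighted_image_def using \<phi>_in
      by (intro Bochner_Integration.integral_cong) (auto simp: X_def indicator_def)
    finally show ?thesis by simp
  qed
  have incr: "SBE_norm \<alpha> p q (weighted_image ?M X (\<lambda>x. m x * indicator {s<..t} x))
      \<le> ennreal ((W t - W s) powr \<beta>)" if st: "a' \<le> s" "s \<le> t" "t \<le> b'" for s t
  proof -
    let ?\<nu> = "weighted_image ?M X (\<lambda>x. m x * indicator {s<..t} x)"
    have in_ab: "\<phi> s \<in> {a..b}" "\<phi> t \<in> {a..b}" using \<phi>_in st by auto
    consider "\<phi> s < \<phi> t" | "\<phi> t < \<phi> s" | "\<phi> s = \<phi> t" by linarith
    then have "SBE_norm \<alpha> p q ?\<nu> \<le> ennreal (\<bar>W1 (\<phi> t) - W1 (\<phi> s)\<bar> powr \<beta>)"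
    proof cases
      case 1
      have "SBE_norm \<alpha> p q ?\<nu> = SBE_norm \<alpha> p q (?occ (\<phi> t) - ?occ (\<phi> s))"
      proof (rule SBE_norm_cong)
        fix B :: "(real ^ 'd) set" assume B: "B \<in> sets borel"
        have segment: "closed_segment (\<phi> s) (\<phi> t) = {\<phi> s..\<phi> t}"
          using 1 by (simp add: closed_segment_eq_real_ivl)
        have "?\<nu> B = measure lebesgue ({x \<in> {a..b}. \<omega> x \<in> B} \<inter> {\<phi> s..\<phi> t})"
          using weighted[OF B st] unfolding segment .
        also have "\<dots> = ?occ (\<phi> t) B - ?occ (\<phi> s) B"
          by (rule occupation_measure_diff[OF \<omega> B, symmetric]) (use 1 in_ab in auto)
        finally show "?\<nu> B = (?occ (\<phi> t) - ?occ (\<phi> s)) B"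
          by (simp only: minus_apply)
      qed
      also have "\<dots> \<le> ennreal ((W1 (\<phi> t) - W1 (\<phi> s)) powr \<beta>)"
        using W1_le 1 in_ab by simp
      finally show ?thesis
        using mono_onD[OF W1 in_ab] 1 by simp
    next
      case 2
      have "SBE_norm \<alpha> p q ?\<nu> = SBE_norm \<alpha> p q (?occ (\<phi> s) - ?occ (\<phi> t))"
      proof (rule SBE_norm_cong)
        fix B :: "(real ^ 'd) set" assume B: "B \<in> sets borel"
        have segment: "closed_segment (\<phi> s) (\<phi> t) = {\<phi> t..\<phi> s}"
          using 2 by (simp add: closed_segment_eq_real_ivl)
        have "?\<nu> B = measure lebesgue ({x \<in> {a..b}. \<omega> x \<in> B} \<inter> {\<phi> t..\<phi> s})"
          using weighted[OF B st] unfolding segment .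
        also have "\<dots> = ?occ (\<phi> s) B - ?occ (\<phi> t) B"
          by (rule occupation_measure_diff[OF \<omega> B, symmetric]) (use 2 in_ab in auto)
        finally show "?\<nu> B = (?occ (\<phi> s) - ?occ (\<phi> t)) B"
          by (simp only: minus_apply)
      qed
      also have "\<dots> \<le> ennreal ((W1 (\<phi> s) - W1 (\<phi> t)) powr \<beta>)"
        using W1_le 2 in_ab by simp
      finally show ?thesis
        using mono_onD[OF W1 in_ab(2,1)] 2 by (simp add: abs_minus_commute)
    next
      case 3
      have "negligible ({x \<in> {a..b}. \<omega> x \<in> B} \<inter> {\<phi> t})" for B
        by (rule negligible_subset[of "{\<phi> t}"]) auto
      then have "?\<nu> B = 0" if "B \<in> sets borel" for B
        using that 3 by (simp add: weighted[OF _ st] negligible_imp_measure0)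
      then show ?thesis
        by (simp add: SBE_norm_null p q)
    qed
    also have "\<dots> \<le> ennreal ((W t - W s) powr \<beta>)"
      using W3_eq[OF st] W3_W[OF st] W3_nonneg[OF st] \<beta> by (intro ennreal_leI powr_mono2) auto
    finally show ?thesis .
  qed
  have G_le: "\<bar>G t - G s\<bar> \<le> 1 / c\<^sup>2 * (W t - W s) powr \<gamma>" if st: "a' \<le> s" "s \<le> t" "t \<le> b'" for s t
  proof -
    have "G t - G s = (m s - m t) / (m t * m s)"
      using m_pos[of s] m_pos[of t] by (simp add: G_def field_simps)
    then have "\<bar>G t - G s\<bar> = \<bar>m s - m t\<bar> / (m t * m s)"
      using m_pos[of s] m_pos[of t] by (simp add: abs_mult)
    also have "\<dots> \<le> \<bar>\<phi>' t - \<phi>' s\<bar> / c\<^sup>2"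
    proof (rule frac_le)
      show "c\<^sup>2 \<le> m t * m s"
        unfolding power2_eq_square using m_ge c by (intro mult_mono) (auto intro: less_imp_le m_pos)
      show "\<bar>m s - m t\<bar> \<le> \<bar>\<phi>' t - \<phi>' s\<bar>"
        unfolding m_def by (auto simp: max_def)
    qed (use c in auto)
    also have "\<dots> \<le> (W t - W s) powr \<gamma> / c\<^sup>2"
      using \<phi>'_le[OF st] c by (intro divide_right_mono) auto
    finally show ?thesis by simp
  qed

  \<comment> \<open>The factor \<open>(W t - W s)\<^sup>\<gamma>\<close> of Young's bound is absorbed into \<open>D\<close>, which leaves the exponent \<open>1 / r\<close>.\<close>
  define Z where "Z = (\<Sum>k. real k powr - (\<beta> + \<gamma>))"
  have Z: "0 \<le> Z"
    unfolding Z_def using young by (intro suminf_nonneg) (auto simp: summable_real_powr_iff)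
  define D where "D = 1 / c + 1 / c\<^sup>2 * 2 powr (\<beta> + \<gamma>) * (W b' - W a') powr \<gamma> * Z"
  have D: "0 \<le> D"
    using c Z by (simp add: D_def)
  have main: "SBE_norm \<alpha> p q (weighted_image ?M X (indicator {s<..t})) \<le> ennreal (D * (W t - W s) powr \<beta>)"
    if st: "a' \<le> s" "s \<le> t" "t \<le> b'" for s t
  proof -
    define w where "w = W t - W s"
    have w: "0 \<le> w" "w \<le> W b' - W a'"
      using st mono_onD[OF W, of s t] mono_onD[OF W, of a' s] mono_onD[OF W, of t b'] by (auto simp: w_def)
    have "(\<lambda>x. G x * (m x * indicator {s<..t} x)) = (indicator {s<..t} :: real \<Rightarrow> real)"
      using m_pos by (auto simp: G_def less_imp_neq[symmetric] fun_eq_iff)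
    then have "SBE_norm \<alpha> p q (weighted_image ?M X (indicator {s<..t}))
        \<le> ennreal (\<bar>G s\<bar> * w powr \<beta> + 1 / c\<^sup>2 * (2 * w) powr (\<beta> + \<gamma>) * Z)"
      using young_weighted_image[OF p q _ X m_int incr W G_le _ _ \<gamma> young st] ab' c \<beta>
      unfolding w_def Z_def by simp
    also have "\<dots> \<le> ennreal (D * w powr \<beta>)"
    proof (rule ennreal_leI)
      have "\<bar>G s\<bar> \<le> 1 / c"
        using m_ge[of s] m_pos[of s] c by (simp add: G_def frac_le)
      then have "\<bar>G s\<bar> * w powr \<beta> \<le> 1 / c * w powr \<beta>"
        by (intro mult_right_mono) auto
      moreover have "(2 * w) powr (\<beta> + \<gamma>) \<le> 2 powr (\<beta> + \<gamma>) * ((W b' - W a') powr \<gamma> * w powr \<beta>)"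
      proof -
        have "(2 * w) powr (\<beta> + \<gamma>) = 2 powr (\<beta> + \<gamma>) * (w powr \<gamma> * w powr \<beta>)"
          using w by (simp add: powr_mult powr_add mult_ac)
        also have "\<dots> \<le> 2 powr (\<beta> + \<gamma>) * ((W b' - W a') powr \<gamma> * w powr \<beta>)"
          using w \<gamma> by (intro mult_left_mono mult_right_mono powr_mono2) auto
        finally show ?thesis .
      qed
      then have "1 / c\<^sup>2 * (2 * w) powr (\<beta> + \<gamma>) * Z
          \<le> 1 / c\<^sup>2 * (2 powr (\<beta> + \<gamma>) * ((W b' - W a') powr \<gamma> * w powr \<beta>)) * Z"
        using Z by (intro mult_right_mono mult_left_mono) auto
      ultimately show "\<bar>G s\<bar> * w powr \<beta> + 1 / c\<^sup>2 * (2 * w) powr (\<beta> + \<gamma>) * Z \<le> D * w powr \<beta>"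
        unfolding D_def by (simp add: algebra_simps)
    qed
    finally show ?thesis by (simp add: w_def)
  qed

  have in_SBE: "occupation_measure X a' t \<in> SBE \<alpha> p q" if t: "t \<in> {a'..b'}" for t
  proof -
    have "SBE_norm \<alpha> p q (occupation_measure X a' t)
        = SBE_norm \<alpha> p q (weighted_image ?M X (indicator {a'<..t}))"
    proof (rule SBE_norm_cong)
      fix B :: "(real ^ 'd) set" assume "B \<in> sets borel"
      then show "occupation_measure X a' t B = weighted_image ?M X (indicator {a'<..t}) B"
        using occupation_measure_diff_eq_weighted_image[OF X, of B a' t] t
        by (simp add: occupation_measure_start)
    qed
    also have "\<dots> \<le> ennreal (D * (W t - W a') powr \<beta>)"
      using t by (intro main) auto
    also have "\<dots> < \<infinity>" by simp
    finally have "SBE_norm \<alpha> p q (occupation_measure X a' t) < \<infinity>" .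
    moreover have "compactly_supported (occupation_measure X a' t)"
    proof -
      have supp: "compactly_supported (?occ x)" if "x \<in> {a..b}" for x
        using assms(8) that by (auto simp: finite_variation_space_def SBE_def)
      obtain K1 K2 where K: "compact K1" "compact K2"
        and K1: "\<And>B. B \<in> sets borel \<Longrightarrow> B \<inter> K1 = {} \<Longrightarrow> ?occ (\<phi> a') B = 0"
        and K2: "\<And>B. B \<in> sets borel \<Longrightarrow> B \<inter> K2 = {} \<Longrightarrow> ?occ (\<phi> b') B = 0"
        using supp[OF \<phi>_in, of a'] supp[OF \<phi>_in, of b'] ab' unfolding compactly_supported_def by auto
      have "occupation_measure X a' t B = 0" if B: "B \<in> sets borel" "B \<inter> (K1 \<union> K2) = {}" for B
      proof -
        have in_ab: "\<phi> a' \<in> {a..b}" "\<phi> b' \<in> {a..b}"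
          using \<phi>_in ab' by auto
        have zero: "?occ (\<phi> a') B = 0" "?occ (\<phi> b') B = 0"
          using K1[OF B(1)] K2[OF B(1)] B(2) by auto
        have seg: "measure lebesgue ({x \<in> {a..b}. \<omega> x \<in> B} \<inter> closed_segment (\<phi> a') (\<phi> b')) = 0"
        proof (cases "\<phi> a' \<le> \<phi> b'")
          case True
          then show ?thesis
            using occupation_measure_diff[OF \<omega> B(1), of "\<phi> a'" "\<phi> b'"] in_ab zero
            unfolding closed_segment_eq_real_ivl by simp
        next
          case False
          then show ?thesis
            using occupation_measure_diff[OF \<omega> B(1), of "\<phi> b'" "\<phi> a'"] in_ab zero
            unfolding closed_segment_eq_real_ivl by simp
        qed
        have "occupation_measure X a' t B = weighted_image ?M X (indicator {a'<..t}) B"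
          using occupation_measure_diff_eq_weighted_image[OF X B(1), of a' t] t
          by (simp add: occupation_measure_start)
        \<comment> \<open>Since \<open>m \<ge> c\<close>, the old occupation measure between \<open>\<phi> a'\<close> and \<open>\<phi> b'\<close> dominates the new one up to the factor \<open>1 / c\<close>.\<close>
        also have "\<dots> \<le> (LINT x|?M. 1 / c * (m x * indicator {a'<..b'} x * indicator B (X x)))"
          unfolding weighted_image_def
        proof (rule integral_mono')
          show "integrable ?M (\<lambda>x. 1 / c * (m x * indicator {a'<..b'} x * indicator B (X x)))"
            by (intro integrable_mult_right integrable_weight_indicator[OF _ X B(1)] m_indicator_int)
          show "indicator {a'<..t} x * indicator B (X x) \<le> 1 / c * (m x * indicator {a'<..b'} x * indicator B (X x))"
            if "x \<in> space ?M" for x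
            using m_ge[of x] c t by (auto simp: indicator_def)
          show "0 \<le> 1 / c * (m x * indicator {a'<..b'} x * indicator B (X x))" for x
            using m_pos[of x] c by (simp add: less_imp_le)
        qed
        also have "\<dots> = 1 / c * weighted_image ?M X (\<lambda>x. m x * indicator {a'<..b'} x) B"
          unfolding weighted_image_def by simp
        also have "\<dots> = 0"
          using weighted[OF B(1), of a' b'] ab' seg by simp
        finally show ?thesis
          by (simp add: occupation_measure_def measure_le_0_iff)
      qed
      then show ?thesis
        unfolding compactly_supported_def using compact_Un[OF K] by blast
    qed
    moreover have "finite_signed_measure (occupation_measure X a' t)"
      using finite_signed_measure_occupation[OF X] t by simp
    ultimately show ?thesis
      by (simp add: SBE_def)
  qed

  show ?thesis
    unfolding X_def[symmetric]
  proof (rule finite_variation_spaceI[OF _ D W in_SBE])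
    show "0 < r" using \<open>r > 1\<close> by simp
    fix s t assume st: "a' \<le> s" "s < t" "t \<le> b'"
    have "SBE_norm \<alpha> p q (occupation_measure X a' t - occupation_measure X a' s)
        = SBE_norm \<alpha> p q (weighted_image ?M X (indicator {s<..t}))"
      using occupation_measure_diff_eq_weighted_image[OF X, of _ s t] st
      by (intro SBE_norm_cong) simp
    then show "SBE_norm \<alpha> p q (occupation_measure X a' t - occupation_measure X a' s)
        \<le> ennreal (D * (W t - W s) powr (1 / r))"
      using main[of s t] st by (simp add: \<beta>_def)
  qed
qed

end
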